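(* Let $G$ be an undirected graph with $n$ vertices. Then the Spohn CI variety $\mathcal V_{X,G}$ of a generic game $X$ and the graph $G$ is nonempty if one of the following conditions holds: (1) the vertex of $G$ standing for the player with the highest number of pure strategies is not isolated; (2) the graph $G$ has no isolated vertex; (3) the graph $G$ is connected.
   Context: Write $[d]=\{1,\dots,d\}$ and $\mathcal R_C=\prod_{i\in C}[d_i]$ for $C\subseteq[n]$. There are $n$ players, identified with the vertices of $G$; player $i$ has $d_i$ pure strategies. A vertex of $G$ is isolated if no edge of $G$ contains it. A $d_1\times\cdots\times d_n$ game is a tuple $X=(X^{(1)},\dots,X^{(n)})$ of real tensors $X^{(k)}=(X^{(k)}_{j_1\cdots j_n})\in\mathbb R^{d_1\times\cdots\times d_n}$ (payoff tensor of player $k$). A statement holds for a generic game if it holds for all $X$ in a nonempty Zariski open subset of $(\mathbb R^{d_1\times\cdots\times d_n})^n$. Let $\mathbb P^{d_1\cdots d_n-1}$ be complex projective space with coordinates $p_{j_1\cdots j_n}$, $(j_1,\dots,j_n)\in\mathcal R_{[n]}$. An index replaced by $+$ means summation over that index. Spohn variety: $\mathcal V_X\subseteq\mathbb P^{d_1\cdots d_n-1}$ is the common vanishing set, over all $k\in[n]$, of the $2\times2$ minors of the $d_k\times 2$ matrix $M^{(k)}$ whose $i$-th row ($i\in[d_k]$) is $\big(p_{+\cdots+i+\cdots+},\ \sum_{j:\,j_k=i}X^{(k)}_{j_1\cdots j_n}p_{j_1\cdots j_n}\big)$, with $i$ in position $k$. Parametrized undirected graphical model: let $\mathcal C(G)$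 be the set of maximal cliques of $G$. $\mathcal M_G\subseteq\mathbb P^{d_1\cdots d_n-1}$ is the projective toric variety that is the Zariski closure of the image of the monomial parametrization $p_{j_1\cdots j_n}=\prod_{C\in\mathcal C(G)}\sigma^{(C)}_{j_C}$, with parameters $\sigma^{(C)}\in\mathbb C^{\mathcal R_C}$ and $j_C=(j_i)_{i\in C}$. Spohn CI variety: $\mathcal V_{X,G}$ is the Zariski closure of $(\mathcal V_X\cap\mathcal M_G)\setminus\mathcal W$, where $\mathcal W$ is the union of the hyperplanes $\{p_j=0\}$ for $j\in\mathcal R_{[n]}$ and the hyperplane $\{p_{+\cdots+}=0\}$.
   Formalization: The formal statement assumes at least two players and at least two pure strategies for each player; without this the claim fails, e.g. for one player with two strategies, or for two adjacent players with 1 and 2 strategies, where the variety is generically empty. *)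

theory Defs
  imports Complex_Main "HOL-Library.FuncSet" "HOL-Library.Poly_Mapping"
begin

text \<open>
  Polynomials are finitely supported maps from exponent vectors to coefficients. Affine space over
  a field with coordinates indexed by a finite set \<open>I\<close> is \<open>I \<rightarrow>\<^sub>E UNIV\<close>.
\<close>

type_synonym ('i, 'a) mpoly = "('i \<Rightarrow>\<^sub>0 nat) \<Rightarrow>\<^sub>0 'a"

definition mpoly_vars :: "('i, 'a::zero) mpoly \<Rightarrow> 'i set" where
  "mpoly_vars f = (\<Union>m\<in>Poly_Mapping.keys f. Poly_Mapping.keys m)"

definition mpoly_eval :: "('i, 'a::comm_semiring_1) mpoly \<Rightarrow> ('i \<Rightarrow> 'a) \<Rightarrow> 'a" where
  "mpoly_eval f x = (\<Sum>m\<in>Poly_Mapping.keys f. Poly_Mapping.lookup f m * (\<Prod>i\<in>Poly_Mapping.keys m. x i ^ Poly_Mapping.lookup m i))"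

definition mpoly_homogeneous :: "('i, 'a::zero) mpoly \<Rightarrow> bool" where
  "mpoly_homogeneous f \<longleftrightarrow> (\<exists>e. \<forall>m\<in>Poly_Mapping.keys f. (\<Sum>i\<in>Poly_Mapping.keys m. Poly_Mapping.lookup m i) = e)"

definition zariski_open :: "'i set \<Rightarrow> ('i \<Rightarrow> 'a::field) set \<Rightarrow> bool" where
  "zariski_open I U \<longleftrightarrow>
     (\<exists>F :: ('i, 'a) mpoly set. (\<forall>f\<in>F. mpoly_vars f \<subseteq> I) \<and>
        U = {x \<in> I \<rightarrow>\<^sub>E UNIV. \<exists>f\<in>F. mpoly_eval f x \<noteq> 0})"

definition generic :: "'i set \<Rightarrow> (('i \<Rightarrow> 'a::field) \<Rightarrow> bool) \<Rightarrow> bool" where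
  "generic I P \<longleftrightarrow> (\<exists>U. zariski_open I U \<and> U \<noteq> {} \<and> (\<forall>x\<in>U. P x))"


text \<open>
  A point of projective space is the set of all its vectors of homogeneous coordinates.
\<close>

definition nonzero_vectors :: "'i set \<Rightarrow> ('i \<Rightarrow> complex) set" where
  "nonzero_vectors I = {v \<in> I \<rightarrow>\<^sub>E UNIV. \<exists>i\<in>I. v i \<noteq> 0}"

definition proportional :: "'i set \<Rightarrow> (('i \<Rightarrow> complex) \<times> ('i \<Rightarrow> complex)) set" where
  "proportional I = {(u, v). u \<in> nonzero_vectors I \<and> v \<in> nonzero_vectors I \<and>
                             (\<exists>c. c \<noteq> 0 \<and> (\<forall>i\<in>I. v i = c * u i))}"

definition proj_space :: "'i set \<Rightarrow> ('i \<Rightarrow> complex) set set" where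
  "proj_space I = nonzero_vectors I // proportional I"

definition proj_closed :: "'i set \<Rightarrow> ('i \<Rightarrow> complex) set set \<Rightarrow> bool" where
  "proj_closed I Z \<longleftrightarrow>
     (\<exists>F :: ('i, complex) mpoly set.
        (\<forall>f\<in>F. mpoly_homogeneous f \<and> mpoly_vars f \<subseteq> I) \<and>
        Z = {x \<in> proj_space I. \<forall>f\<in>F. \<forall>p\<in>x. mpoly_eval f p = 0})"

definition proj_closure :: "'i set \<Rightarrow> ('i \<Rightarrow> complex) set set \<Rightarrow> ('i \<Rightarrow> complex) set set" where
  "proj_closure I S = proj_closed I hull S"


text \<open>
  Graphs have vertex set \<open>{1..n}\<close> and are given by their set of edges.
\<close>

definition simple_graph :: "nat \<Rightarrow> nat set set \<Rightarrow> bool" where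
  "simple_graph n E \<longleftrightarrow> (\<forall>e\<in>E. e \<subseteq> {1..n} \<and> card e = 2)"

definition isolated :: "nat set set \<Rightarrow> nat \<Rightarrow> bool" where
  "isolated E v \<longleftrightarrow> (\<forall>e\<in>E. v \<notin> e)"

definition connected_graph :: "nat \<Rightarrow> nat set set \<Rightarrow> bool" where
  "connected_graph n E \<longleftrightarrow> (\<forall>u\<in>{1..n}. \<forall>v\<in>{1..n}. (u, v) \<in> {(x, y). {x, y} \<in> E}\<^sup>*)"

definition clique :: "nat \<Rightarrow> nat set set \<Rightarrow> nat set \<Rightarrow> bool" where
  "clique n E C \<longleftrightarrow> C \<subseteq> {1..n} \<and> (\<forall>u\<in>C. \<forall>v\<in>C. u \<noteq> v \<longrightarrow> {u, v} \<in> E)"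

definition maximal_cliques :: "nat \<Rightarrow> nat set set \<Rightarrow> nat set set" where
  "maximal_cliques n E = {C. clique n E C \<and> (\<forall>D. clique n E D \<and> C \<subseteq> D \<longrightarrow> D = C)}"


definition profiles :: "(nat \<Rightarrow> nat) \<Rightarrow> nat set \<Rightarrow> (nat \<Rightarrow> nat) set" where
  "profiles d C = (\<Pi>\<^sub>E i\<in>C. {1..d i})"

text \<open>
  A game \<open>X\<close> is a point of the real affine space with coordinates indexed by \<open>game_index n d\<close>;
  \<open>X (k, j)\<close> is the payoff of player \<open>k\<close> at the strategy profile \<open>j\<close>.
\<close>

type_synonym game = "nat \<times> (nat \<Rightarrow> nat) \<Rightarrow> real"

definition game_index :: "nat \<Rightarrow> (nat \<Rightarrow> nat) \<Rightarrow> (nat \<times> (nat \<Rightarrow> nat)) set" where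
  "game_index n d = {1..n} \<times> profiles d {1..n}"

definition marginal :: "nat \<Rightarrow> (nat \<Rightarrow> nat) \<Rightarrow> nat \<Rightarrow> nat \<Rightarrow> ((nat \<Rightarrow> nat) \<Rightarrow> complex) \<Rightarrow> complex" where
  "marginal n d k i p = (\<Sum>j\<in>{j \<in> profiles d {1..n}. j k = i}. p j)"

definition payoff_sum ::
    "nat \<Rightarrow> (nat \<Rightarrow> nat) \<Rightarrow> game \<Rightarrow> nat \<Rightarrow> nat \<Rightarrow> ((nat \<Rightarrow> nat) \<Rightarrow> complex) \<Rightarrow> complex" where
  "payoff_sum n d X k i p =
     (\<Sum>j\<in>{j \<in> profiles d {1..n}. j k = i}. complex_of_real (X (k, j)) * p j)"

text \<open>
  Row \<open>i\<close> of the matrix of player \<open>k\<close> is \<open>(marginal n d k i p, payoff_sum n d X k i p)\<close>.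
\<close>

definition spohn_variety ::
    "nat \<Rightarrow> (nat \<Rightarrow> nat) \<Rightarrow> game \<Rightarrow> ((nat \<Rightarrow> nat) \<Rightarrow> complex) set set" where
  "spohn_variety n d X =
     {x \<in> proj_space (profiles d {1..n}).
        \<forall>p\<in>x. \<forall>k\<in>{1..n}. \<forall>i\<in>{1..d k}. \<forall>i'\<in>{1..d k}.
          marginal n d k i p * payoff_sum n d X k i' p
            - marginal n d k i' p * payoff_sum n d X k i p = 0}"

text \<open>
  \<open>\<sigma> C\<close> is only ever evaluated on \<open>profiles d C\<close>.
\<close>

definition clique_parametrization ::
    "nat \<Rightarrow> (nat \<Rightarrow> nat) \<Rightarrow> nat set set \<Rightarrow> (nat set \<Rightarrow> (nat \<Rightarrow> nat) \<Rightarrow> complex) \<Rightarrow>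
       (nat \<Rightarrow> nat) \<Rightarrow> complex" where
  "clique_parametrization n d E \<sigma> =
     (\<lambda>j\<in>profiles d {1..n}. \<Prod>C\<in>maximal_cliques n E. \<sigma> C (restrict j C))"

text \<open>
  The parametrization is only a rational map to projective space, undefined where all the
  coordinates vanish.
\<close>

definition graphical_model ::
    "nat \<Rightarrow> (nat \<Rightarrow> nat) \<Rightarrow> nat set set \<Rightarrow> ((nat \<Rightarrow> nat) \<Rightarrow> complex) set set" where
  "graphical_model n d E =
     proj_closure (profiles d {1..n})
       {x \<in> proj_space (profiles d {1..n}). \<exists>\<sigma>. clique_parametrization n d E \<sigma> \<in> x}"

definition excluded_hyperplanes ::
    "nat \<Rightarrow> (nat \<Rightarrow> nat) \<Rightarrow> ((nat \<Rightarrow> nat) \<Rightarrow> complex) set set" where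
  "excluded_hyperplanes n d =
     (\<Union>j\<in>profiles d {1..n}. {x \<in> proj_space (profiles d {1..n}). \<forall>p\<in>x. p j = 0})
     \<union> {x \<in> proj_space (profiles d {1..n}). \<forall>p\<in>x. (\<Sum>j\<in>profiles d {1..n}. p j) = 0}"

definition spohn_CI_variety ::
    "nat \<Rightarrow> (nat \<Rightarrow> nat) \<Rightarrow> game \<Rightarrow> nat set set \<Rightarrow> ((nat \<Rightarrow> nat) \<Rightarrow> complex) set set" where
  "spohn_CI_variety n d X E =
     proj_closure (profiles d {1..n})
       (spohn_variety n d X \<inter> graphical_model n d E - excluded_hyperplanes n d)"

end

(*
  Each of the three conditions provides a player M with the highest number of pure strategies who has
  a neighbour M'. It suffices to look for points
    p_j = x^1_{j_1} ... x^n_{j_n} s_j,   s_j = sigma_{j_M} if j_{M'} = 2 and j_M > 1, and 1 otherwise,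
  where x^l_1 = 1 and x^{M'} = 1; only the edge {M, M'} interacts. If player k obtains the same
  conditional payoff lambda_k from each of her strategies, then p lies on the Spohn variety. Given x,
  sigma and lambda these conditions are linear in the payoffs, and can be solved for the payoffs at the
  profiles (1,...,1,i,1,...,1). This gives a polynomial map from the parameters (lambda, x, sigma,
  remaining payoffs) to games, so one needs that its image contains a nonempty Zariski open set, with
  parameters off the hypersurface where some p_j or the sum of all p_j vanishes.

  A dominant polynomial map has this property: homomorphisms to the complex numbers, defined on a
  subring of a domain and nonvanishing at a suitable element, extend over finitely many generators
  (one generator at a time, by pseudo-division and the univariate Nullstellensatz).

  For dominance it is enough that the derivative at one point is onto. At lambda = 0, x = sigma = 1,
  the direction lambda_k corrects the equation (k, 1), and the free payoffs can be chosen such that the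
  equation (k, i) with i > 1 sees a single coordinate sigma_i (for k = M) or x^l_a (for other k). The
  pairs (l, a) have to be distinct, with l different from k and M'; such a matching exists because d_M
  is maximal. Real games suffice because a nonzero complex polynomial does not vanish on all real points.
*)

theory Submission
  imports Defs "HOL-Library.Function_Algebras"
    "HOL-Computational_Algebra.Fundamental_Theorem_Algebra"
begin

section \<open>Polynomial functions\<close>

text \<open>Polynomials are taken as functions, so that pulling back along a polynomial map is plain
  composition. Over the infinite field of complex numbers, equality of functions is equality of
  polynomials.\<close>

inductive polyfun :: "'i set \<Rightarrow> (('i \<Rightarrow> 'a::comm_ring_1) \<Rightarrow> 'a) \<Rightarrow> bool" for I where
  const: "polyfun I (\<lambda>x. c)"
| coord: "i \<in> I \<Longrightarrow> polyfun I (\<lambda>x. x i)"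
| add: "polyfun I f \<Longrightarrow> polyfun I g \<Longrightarrow> polyfun I (\<lambda>x. f x + g x)"
| mult: "polyfun I f \<Longrightarrow> polyfun I g \<Longrightarrow> polyfun I (\<lambda>x. f x * g x)"

lemma polyfun_uminus: "polyfun I f \<Longrightarrow> polyfun I (\<lambda>x. - f x)"
  using polyfun.mult[OF polyfun.const[of I "- 1"], of f] by simp

lemma polyfun_diff: "polyfun I f \<Longrightarrow> polyfun I g \<Longrightarrow> polyfun I (\<lambda>x. f x - g x)"
  using polyfun.add[OF _ polyfun_uminus, of I f g] by simp

lemma polyfun_sum: "(\<And>a. a \<in> A \<Longrightarrow> polyfun I (f a)) \<Longrightarrow> polyfun I (\<lambda>x. \<Sum>a\<in>A. f a x)"
  by (induction A rule: infinite_finite_induct) (auto intro: polyfun.intros)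

lemma polyfun_prod: "(\<And>a. a \<in> A \<Longrightarrow> polyfun I (f a)) \<Longrightarrow> polyfun I (\<lambda>x. \<Prod>a\<in>A. f a x)"
  by (induction A rule: infinite_finite_induct) (auto intro: polyfun.intros)

lemma polyfun_cong:
  assumes "polyfun I f" "\<And>i. i \<in> I \<Longrightarrow> x i = y i"
  shows "f x = f y"
  using assms by (induction rule: polyfun.induct) auto

lemma polyfun_compose:
  assumes "polyfun J P" "\<And>j. j \<in> J \<Longrightarrow> polyfun I (\<lambda>x. \<Phi> x j)"
  shows "polyfun I (\<lambda>x. P (\<Phi> x))"
  using assms by (induction rule: polyfun.induct) (auto intro: polyfun.intros)

lemma polyfun_on_line:
  fixes f :: "('i \<Rightarrow> complex) \<Rightarrow> complex"
  assumes "polyfun I f"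
  shows "\<exists>p. \<forall>s. f (\<lambda>i. a i + s * b i) = poly p s"
  using assms
proof (induction rule: polyfun.induct)
  case (const c)
  show ?case by (rule exI[of _ "[:c:]"]) simp
next
  case (coord i)
  show ?case by (rule exI[of _ "[:a i, b i:]"]) simp
next
  case (add f g)
  then show ?case by (metis poly_add)
next
  case (mult f g)
  then show ?case by (metis poly_mult)
qed

text \<open>Join a point where \<open>f\<close> is nonzero to one where \<open>g\<close> is nonzero.
  On this line both are nonzero univariate polynomials, and so is their product.\<close>

lemma polyfun_mult_eq_0:
  fixes f g :: "('i \<Rightarrow> complex) \<Rightarrow> complex"
  assumes f: "polyfun I f" and g: "polyfun I g" and fg: "f * g = 0"
  shows "f = 0 \<or> g = 0"
proof (rule ccontr)
  assume "\<not> ?thesis"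
  then obtain a b where ab: "f a \<noteq> 0" "g b \<noteq> 0"
    by (metis ext zero_fun_apply)
  define l where "l = (\<lambda>s i. a i + s * (b i - a i))"
  obtain p q where p: "\<And>s. f (l s) = poly p s" and q: "\<And>s. g (l s) = poly q s"
    unfolding l_def using polyfun_on_line[OF f] polyfun_on_line[OF g] by metis
  have "poly p 0 \<noteq> 0" "poly q 1 \<noteq> 0"
    using ab by (simp_all flip: p q add: l_def)
  then have "p * q \<noteq> 0" by auto
  moreover have "poly (p * q) s = 0" for s
    using fun_cong[OF fg, of "l s"] by (simp add: p q)
  ultimately show False by (metis poly_all_0_iff_0)
qed

section \<open>Extension of homomorphisms to the complex numbers\<close>

text \<open>Subrings are sets because the ambient type will be the ring of all functions, which has
  zero divisors; being a domain is assumed later of a set \<open>D\<close> only.\<close>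

definition subring_set :: "'a::comm_ring_1 set \<Rightarrow> bool" where
  "subring_set A \<longleftrightarrow> 1 \<in> A \<and> (\<forall>x\<in>A. \<forall>y\<in>A. x - y \<in> A \<and> x * y \<in> A)"

definition hom_on :: "'a::comm_ring_1 set \<Rightarrow> ('a \<Rightarrow> complex) \<Rightarrow> bool" where
  "hom_on A \<phi> \<longleftrightarrow> \<phi> 1 = 1 \<and> (\<forall>x\<in>A. \<forall>y\<in>A. \<phi> (x - y) = \<phi> x - \<phi> y \<and> \<phi> (x * y) = \<phi> x * \<phi> y)"

definition polys_over :: "'a::comm_ring_1 set \<Rightarrow> 'a poly set" where
  "polys_over A = {p. \<forall>i. coeff p i \<in> A}"

definition adjoin :: "'a::comm_ring_1 set \<Rightarrow> 'a \<Rightarrow> 'a set" where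
  "adjoin A b = (\<lambda>p. poly p b) ` polys_over A"

context
  fixes A :: "'a::comm_ring_1 set"
  assumes A: "subring_set A"
begin

lemma subring_one: "1 \<in> A" and subring_diff: "x \<in> A \<Longrightarrow> y \<in> A \<Longrightarrow> x - y \<in> A"
  and subring_mult: "x \<in> A \<Longrightarrow> y \<in> A \<Longrightarrow> x * y \<in> A"
  using A by (auto simp: subring_set_def)

lemma subring_zero: "0 \<in> A"
  using subring_diff[OF subring_one subring_one] by simp

lemma subring_add: "x \<in> A \<Longrightarrow> y \<in> A \<Longrightarrow> x + y \<in> A"
  using subring_diff[OF _ subring_diff[OF subring_zero]] by fastforce

lemma subring_power: "x \<in> A \<Longrightarrow> x ^ n \<in> A"
  by (induction n) (auto intro: subring_one subring_mult)

lemma subring_sum: "(\<And>i. i \<in> S \<Longrightarrow> f i \<in> A) \<Longrightarrow> sum f S \<in> A"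
  by (induction S rule: infinite_finite_induct) (auto intro: subring_zero subring_add)

lemma subring_polys_over: "subring_set (polys_over A)"
  by (auto simp: subring_set_def polys_over_def coeff_mult coeff_1
      intro!: subring_sum subring_mult subring_diff subring_zero subring_one)

lemma polys_over_monom: "a \<in> A \<Longrightarrow> monom a n \<in> polys_over A"
  by (auto simp: polys_over_def subring_zero)

lemma subset_adjoin: "A \<subseteq> adjoin A b"
  using polys_over_monom[of _ 0] by (force simp: adjoin_def monom_0)

lemma mem_adjoin: "b \<in> adjoin A b"
  using polys_over_monom[OF subring_one, of 1]
  by (force simp: adjoin_def poly_monom intro: image_eqI)

text \<open>Long division in which every step first multiplies by the leading coefficient of
  \<open>P\<close>, so that all coefficients stay in \<open>A\<close>.\<close>

lemma polys_over_pseudo_divide: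
  assumes P: "P \<in> polys_over A" "degree P > 0" and Q: "Q \<in> polys_over A"
  shows "\<exists>N. \<exists>S\<in>polys_over A. \<exists>R\<in>polys_over A. degree R < degree P \<and>
           smult (lead_coeff P ^ N) Q = P * S + R"
  using Q
proof (induction "degree Q" arbitrary: Q rule: less_induct)
  case less
  note PA = subring_polys_over
  show ?case
  proof (cases "degree Q < degree P")
    case True
    have "0 \<in> polys_over A"
      by (simp add: polys_over_def subring_zero)
    then show ?thesis
      using True less.prems by (intro exI[of _ 0] bexI[of _ 0] bexI[of _ Q]) auto
  next
    case False
    define M where "M = monom (lead_coeff Q) (degree Q - degree P)"
    define Q' where "Q' = smult (lead_coeff P) Q - P * M"
    have lA: "lead_coeff P \<in> A" "lead_coeff Q \<in> A"
      using P less.prems by (auto simp: polys_over_def)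
    have sm: "smult c p \<in> polys_over A" if "c \<in> A" "p \<in> polys_over A" for c p
      using that by (auto simp: polys_over_def intro: subring_mult)
    have M: "M \<in> polys_over A"
      unfolding M_def by (rule polys_over_monom) fact
    have Q': "Q' \<in> polys_over A"
      unfolding Q'_def using PA sm[OF lA(1) less.prems] M P
      by (auto simp: subring_set_def)
    have "coeff Q' i = 0" if i: "i \<ge> degree Q" for i
    proof (cases "i = degree Q")
      case True
      have "coeff (P * M) i = lead_coeff Q * lead_coeff P"
        using False True by (simp add: M_def coeff_monom_mult mult.commute[of P])
      then show ?thesis
        by (simp add: Q'_def True mult.commute)
    next
      case neq: False
      have "coeff (P * M) i = lead_coeff Q * coeff P (i - (degree Q - degree P))"
        using i by (simp add: M_def coeff_monom_mult mult.commute[of P])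
      also have "coeff P (i - (degree Q - degree P)) = 0"
        using i neq False by (intro coeff_eq_0) auto
      finally show ?thesis
        using i neq by (simp add: Q'_def coeff_eq_0)
    qed
    \<comment> \<open>If the degree did not drop, the leading coefficient of \<open>Q'\<close> would
      vanish, so \<open>Q' = 0\<close> and \<open>degree Q = 0\<close>; this contradicts
      \<open>degree Q \<ge> degree P > 0\<close>.\<close>
    then have "degree Q' < degree Q"
      using P False by (metis bot_nat_0.not_eq_extremum leading_coeff_0_iff degree_0 leI)
    from less.hyps[OF this Q'] obtain N S R where
      SR: "S \<in> polys_over A" "R \<in> polys_over A" "degree R < degree P"
        "smult (lead_coeff P ^ N) Q' = P * S + R" by blast
    have "smult (lead_coeff P ^ Suc N) Q = smult (lead_coeff P ^ N) (Q' + P * M)"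
      by (simp add: Q'_def mult.commute)
    also have "\<dots> = P * (S + smult (lead_coeff P ^ N) M) + R"
      by (simp add: smult_add_right SR algebra_simps)
    finally have "smult (lead_coeff P ^ Suc N) Q = P * (S + smult (lead_coeff P ^ N) M) + R" .
    moreover have "S + smult (lead_coeff P ^ N) M \<in> polys_over A"
      using SR(1) sm[OF subring_power[OF lA(1)] M]
      by (auto simp: polys_over_def intro: subring_add)
    ultimately show ?thesis using SR by blast
  qed
qed

lemma subring_adjoin: "subring_set (adjoin A b)"
proof -
  note PA = subring_polys_over
  have "1 \<in> adjoin A b"
    using subset_adjoin subring_one by blast
  moreover have "x - y \<in> adjoin A b \<and> x * y \<in> adjoin A b" if xy: "x \<in> adjoin A b" "y \<in> adjoin A b" for x y
  proof -
    obtain p q where pq: "p \<in> polys_over A" "q \<in> polys_over A" "x = poly p b" "y = poly q b"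
      using xy unfolding adjoin_def by blast
    then have "p - q \<in> polys_over A" "p * q \<in> polys_over A"
      using PA by (auto simp: subring_set_def)
    then show ?thesis
      unfolding adjoin_def pq(3,4) by (metis imageI poly_diff poly_mult)
  qed
  ultimately show ?thesis by (auto simp: subring_set_def)
qed

context
  fixes \<phi> :: "'a \<Rightarrow> complex"
  assumes \<phi>: "hom_on A \<phi>"
begin

lemma hom_diff: "x \<in> A \<Longrightarrow> y \<in> A \<Longrightarrow> \<phi> (x - y) = \<phi> x - \<phi> y"
  and hom_mult: "x \<in> A \<Longrightarrow> y \<in> A \<Longrightarrow> \<phi> (x * y) = \<phi> x * \<phi> y"
  and hom_one: "\<phi> 1 = 1"
  using \<phi> by (auto simp: hom_on_def)

lemma hom_zero: "\<phi> 0 = 0"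
  using hom_diff[OF subring_one subring_one] by simp

lemma hom_add: "x \<in> A \<Longrightarrow> y \<in> A \<Longrightarrow> \<phi> (x + y) = \<phi> x + \<phi> y"
  using hom_diff[OF _ subring_diff[OF subring_zero], of x y] hom_diff[OF subring_zero, of y]
  by (simp add: hom_zero)

lemma hom_sum: "(\<And>i. i \<in> S \<Longrightarrow> f i \<in> A) \<Longrightarrow> \<phi> (sum f S) = (\<Sum>i\<in>S. \<phi> (f i))"
  by (induction S rule: infinite_finite_induct) (auto simp: hom_zero hom_add subring_sum)

lemma hom_power: "x \<in> A \<Longrightarrow> \<phi> (x ^ n) = \<phi> x ^ n"
  by (induction n) (auto simp: hom_one hom_mult subring_power)

lemma hom_on_map_poly: "hom_on (polys_over A) (\<lambda>p. poly (map_poly \<phi> p) b)"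
proof -
  have "map_poly \<phi> 1 = 1"
    using hom_zero hom_one by (simp add: map_poly_1)
  moreover have "map_poly \<phi> (p - q) = map_poly \<phi> p - map_poly \<phi> q \<and>
      map_poly \<phi> (p * q) = map_poly \<phi> p * map_poly \<phi> q"
    if "p \<in> polys_over A" "q \<in> polys_over A" for p q
    using that by (auto intro!: poly_eqI simp: polys_over_def coeff_map_poly hom_zero coeff_mult
        hom_diff hom_mult hom_sum subring_mult)
  ultimately show ?thesis by (simp add: hom_on_def)
qed

end

end

text \<open>Sending \<open>b\<close> to \<open>c\<close> is well defined because every relation of
  \<open>b\<close> over \<open>A\<close> becomes, under \<phi>, a relation of
  \<open>c\<close>.\<close>

lemma hom_on_adjoin:
  assumes A: "subring_set A" and \<phi>: "hom_on A \<phi>"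
    and root: "\<And>q. q \<in> polys_over A \<Longrightarrow> poly q b = 0 \<Longrightarrow> poly (map_poly \<phi> q) c = 0"
  shows "\<exists>\<psi>. hom_on (adjoin A b) \<psi> \<and> (\<forall>q\<in>polys_over A. \<psi> (poly q b) = poly (map_poly \<phi> q) c)"
proof -
  note PA = subring_polys_over[OF A]
  note h = hom_on_map_poly[OF A \<phi>, of c]
  define \<psi> where "\<psi> = (\<lambda>x. poly (map_poly \<phi> (SOME q. q \<in> polys_over A \<and> poly q b = x)) c)"
  have \<psi>: "\<psi> (poly q b) = poly (map_poly \<phi> q) c" if q: "q \<in> polys_over A" for q
  proof -
    define q' where "q' = (SOME q'. q' \<in> polys_over A \<and> poly q' b = poly q b)"
    have q': "q' \<in> polys_over A \<and> poly q' b = poly q b"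
      unfolding q'_def by (rule someI[of _ q]) (use q in simp)
    then have "q' - q \<in> polys_over A" "poly (q' - q) b = 0"
      using PA q by (auto simp: subring_set_def)
    from root[OF this] show ?thesis
      using h q q' by (simp add: \<psi>_def q'_def hom_on_def)
  qed
  have one: "1 \<in> polys_over A"
    using PA by (simp add: subring_set_def)
  have "hom_on (adjoin A b) \<psi>"
    unfolding hom_on_def
  proof (intro conjI ballI)
    show "\<psi> 1 = 1"
      using \<psi>[OF one] h by (simp add: hom_on_def)
  next
    fix x y assume "x \<in> adjoin A b" "y \<in> adjoin A b"
    then obtain p q where pq: "p \<in> polys_over A" "q \<in> polys_over A" "x = poly p b" "y = poly q b"
      unfolding adjoin_def by blast
    have "p - q \<in> polys_over A" "p * q \<in> polys_over A"
      using PA pq by (auto simp: subring_set_def)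
    from this[THEN \<psi>] show "\<psi> (x - y) = \<psi> x - \<psi> y" "\<psi> (x * y) = \<psi> x * \<psi> y"
      using h pq by (auto simp: \<psi> hom_on_def)
  qed
  with \<psi> show ?thesis by blast
qed

text \<open>An image \<open>c\<close> of \<open>b\<close> is needed that satisfies all relations of
  \<open>b\<close> but is no root of the image of \<open>f\<close>, where
  \<open>F = poly f b\<close>. The element \<open>g\<close> collects the leading coefficients that
  \<phi> must not kill for such a \<open>c\<close> to exist.\<close>

lemma extend_hom_adjoin:
  assumes A: "subring_set A" and D: "subring_set D" "A \<subseteq> D" "b \<in> D"
    and nzd: "\<And>x y. x \<in> D \<Longrightarrow> y \<in> D \<Longrightarrow> x * y = 0 \<Longrightarrow> x = 0 \<or> y = 0"
    and F: "F \<in> adjoin A b" "F \<noteq> 0"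
  shows "\<exists>g\<in>A. g \<noteq> 0 \<and> (\<forall>\<phi>. hom_on A \<phi> \<longrightarrow> \<phi> g \<noteq> 0 \<longrightarrow>
           (\<exists>\<psi>. hom_on (adjoin A b) \<psi> \<and> (\<forall>x\<in>A. \<psi> x = \<phi> x) \<and> \<psi> F \<noteq> 0))"
proof -
  note PA = subring_polys_over[OF A]
  have mapmult: "map_poly \<phi> (p * q) = map_poly \<phi> p * map_poly \<phi> q"
    and mapadd: "map_poly \<phi> (p + q) = map_poly \<phi> p + map_poly \<phi> q"
    and mappow: "map_poly \<phi> (p ^ n) = map_poly \<phi> p ^ n"
    if "p \<in> polys_over A" "q \<in> polys_over A" "hom_on A \<phi>" for p q n \<phi>
  proof -
    have m: "map_poly \<phi> (p * q) = map_poly \<phi> p * map_poly \<phi> q"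
      if "p \<in> polys_over A" "q \<in> polys_over A" for p q
      using that \<open>hom_on A \<phi>\<close>
      by (auto intro!: poly_eqI simp: polys_over_def coeff_map_poly hom_zero[OF A] coeff_mult
        hom_mult[OF A] hom_sum[OF A] subring_mult[OF A])
    show "map_poly \<phi> (p * q) = map_poly \<phi> p * map_poly \<phi> q" using m that by blast
    show "map_poly \<phi> (p + q) = map_poly \<phi> p + map_poly \<phi> q"
      using that by (auto intro!: poly_eqI simp: polys_over_def coeff_map_poly hom_zero[OF A] hom_add[OF A])
    show "map_poly \<phi> (p ^ n) = map_poly \<phi> p ^ n"
      by (induction n) (use that in \<open>auto simp: hom_zero[OF A] hom_one[OF A] map_poly_1 m subring_power[OF PA]\<close>)
  qed
  have mapsmult: "map_poly \<phi> (smult a p) = smult (\<phi> a) (map_poly \<phi> p)"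
    if "p \<in> polys_over A" "a \<in> A" "hom_on A \<phi>" for p a \<phi>
    using that by (auto intro!: poly_eqI simp: polys_over_def coeff_map_poly hom_zero[OF A] hom_mult[OF A])
  have restr: "\<exists>\<psi>. hom_on (adjoin A b) \<psi> \<and> (\<forall>x\<in>A. \<psi> x = \<phi> x) \<and> \<psi> F \<noteq> 0"
    if \<phi>: "hom_on A \<phi>" and root: "\<And>q. q \<in> polys_over A \<Longrightarrow> poly q b = 0 \<Longrightarrow> poly (map_poly \<phi> q) c = 0"
      and f: "f \<in> polys_over A" "F = poly f b" "poly (map_poly \<phi> f) c \<noteq> 0" for \<phi> c f
  proof -
    obtain \<psi> where \<psi>: "hom_on (adjoin A b) \<psi>"
      "\<And>q. q \<in> polys_over A \<Longrightarrow> \<psi> (poly q b) = poly (map_poly \<phi> q) c"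
      using hom_on_adjoin[OF A \<phi> root] by blast
    have "\<psi> x = \<phi> x" if "x \<in> A" for x
      using \<psi>(2)[OF polys_over_monom[OF A that, of 0]] \<phi>
      by (simp add: monom_0 map_poly_pCons hom_zero[OF A])
    with \<psi> f show ?thesis by auto
  qed
  obtain f where f: "f \<in> polys_over A" "F = poly f b"
    using F(1) unfolding adjoin_def by blast
  have lcA: "lead_coeff p \<in> A" if "p \<in> polys_over A" for p
    using that by (auto simp: polys_over_def)
  show ?thesis
  proof (cases "\<exists>P\<in>polys_over A. P \<noteq> 0 \<and> poly P b = 0")
    \<comment> \<open>Here \<open>b\<close> is transcendental over \<open>A\<close>: no relation
      constrains \<open>c\<close>, and it only has to avoid the roots of the image of
      \<open>f\<close>, which is nonzero.\<close>
    case False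
    have "f \<noteq> 0" using f F(2) by auto
    show ?thesis
    proof (intro bexI[of _ "lead_coeff f"] conjI allI impI)
      fix \<phi> assume \<phi>: "hom_on A \<phi>" "\<phi> (lead_coeff f) \<noteq> 0"
      then have "coeff (map_poly \<phi> f) (degree f) \<noteq> 0"
        by (simp add: coeff_map_poly hom_zero[OF A])
      then have "map_poly \<phi> f \<noteq> 0" by auto
      then obtain c where c: "poly (map_poly \<phi> f) c \<noteq> 0"
        using poly_all_0_iff_0 by blast
      show "\<exists>\<psi>. hom_on (adjoin A b) \<psi> \<and> (\<forall>x\<in>A. \<psi> x = \<phi> x) \<and> \<psi> F \<noteq> 0"
        using False by (intro restr[OF \<phi>(1) _ f c]) auto
    qed (use \<open>f \<noteq> 0\<close> lcA[OF f(1)] in auto)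
  next
    case True
    \<comment> \<open>A relation of least degree replaces the minimal polynomial: up to powers of
      its leading coefficient, it divides every other relation.\<close>
    then obtain P where P: "P \<in> polys_over A" "P \<noteq> 0" "poly P b = 0"
      and min: "\<And>Q. Q \<in> polys_over A \<Longrightarrow> Q \<noteq> 0 \<Longrightarrow> poly Q b = 0 \<Longrightarrow> degree P \<le> degree Q"
      using ex_has_least_nat[of "\<lambda>P. P \<in> polys_over A \<and> P \<noteq> 0 \<and> poly P b = 0" _ degree] by blast
    define a where "a = lead_coeff P"
    have a: "a \<in> A" "a \<noteq> 0" using P lcA by (auto simp: a_def)
    have degP: "degree P > 0"
    proof (rule ccontr)
      assume "\<not> ?thesis"
      then obtain e where "P = [:e:]" by (auto elim: degree_eq_zeroE)
      then show False using P by auto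
    qed
    \<comment> \<open>The exponent is the one that occurs in the univariate Nullstellensatz
      below.\<close>
    have pw: "f ^ degree P \<in> polys_over A"
      using f PA by (intro subring_power)
    obtain N S R where R: "S \<in> polys_over A" "R \<in> polys_over A" "degree R < degree P"
      "smult (a ^ N) (f ^ degree P) = P * S + R"
      using polys_over_pseudo_divide[OF A P(1) degP pw] by (auto simp: a_def)
    have AD: "x ^ k \<in> D" if "x \<in> D" for x k
      using subring_power[OF D(1)] that by blast
    have adD: "F \<in> D"
    proof -
      have "coeff f i \<in> D" for i using f D by (auto simp: polys_over_def)
      then show ?thesis
        unfolding f(2) poly_altdef by (intro subring_sum[OF D(1)] subring_mult[OF D(1)] AD D(3))
    qed
    have pow0: "x ^ k \<noteq> 0" if "x \<in> D" "x \<noteq> 0" for x k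
      using that by (induction k) (auto dest: nzd[OF that(1) AD[OF that(1)]])
    \<comment> \<open>The remainder is nonzero because its value at \<open>b\<close> is a product of
      nonzero elements of the domain \<open>D\<close>.\<close>
    have "poly R b = a ^ N * F ^ degree P"
      using arg_cong[OF R(4), of "\<lambda>p. poly p b"] P f by simp
    moreover have "a ^ N * F ^ degree P \<noteq> 0"
      using nzd[OF AD AD] pow0 a adD D(2) F(2) by blast
    ultimately have "R \<noteq> 0" by auto
    show ?thesis
    proof (intro bexI[of _ "a * lead_coeff R"] conjI allI impI)
      show "a * lead_coeff R \<in> A" using a lcA[OF R(2)] subring_mult[OF A] by blast
      show "a * lead_coeff R \<noteq> 0" using nzd[of a "lead_coeff R"] a lcA[OF R(2)] D \<open>R \<noteq> 0\<close> by auto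
    next
      fix \<phi> assume \<phi>: "hom_on A \<phi>" and g: "\<phi> (a * lead_coeff R) \<noteq> 0"
      have \<phi>a: "\<phi> a \<noteq> 0" "\<phi> (lead_coeff R) \<noteq> 0"
        using g hom_mult[OF A \<phi> a(1) lcA[OF R(2)]] by auto
      have coeff: "coeff (map_poly \<phi> p) i = \<phi> (coeff p i)" for p i
        by (simp add: coeff_map_poly hom_zero[OF A \<phi>])
      define P' f' R' where "P' = map_poly \<phi> P" and "f' = map_poly \<phi> f" and "R' = map_poly \<phi> R"
      have degP': "degree P' = degree P"
        unfolding P'_def using \<phi>a by (simp add: map_poly_degree_eq a_def)
      have R': "R' \<noteq> 0" "degree R' < degree P'"
      proof -
        show "R' \<noteq> 0"
          using \<phi>a(2) coeff[of R "degree R"] by (auto simp: R'_def)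
        have "degree R' \<le> degree R"
          by (rule degree_le) (simp add: R'_def coeff coeff_eq_0 hom_zero[OF A \<phi>])
        then show "degree R' < degree P'" using R(3) degP' by simp
      qed
      \<comment> \<open>If all roots of \<open>P'\<close> were roots of \<open>f'\<close>, then
        \<open>P'\<close> would divide a power of \<open>f'\<close>, hence also the nonzero
        remainder \<open>R'\<close> of smaller degree.\<close>
      have "\<exists>c. poly P' c = 0 \<and> poly f' c \<noteq> 0"
      proof (rule ccontr)
        assume "\<not> ?thesis"
        then have "P' dvd f' ^ degree P'"
          using nullstellensatz_univariate[of P' f'] degP' degP by auto
        moreover have "smult (\<phi> a ^ N) (f' ^ degree P') = P' * map_poly \<phi> S + R'"
        proof -
          have PS: "P * S \<in> polys_over A" using subring_mult[OF PA] P R by blast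
          have "map_poly \<phi> (smult (a ^ N) (f ^ degree P)) = smult (\<phi> a ^ N) (f' ^ degree P')"
            using a f by (simp add: mapsmult[OF pw _ \<phi>] subring_power[OF A] hom_power[OF A \<phi>]
                mappow[OF f(1) f(1) \<phi>] f'_def degP')
          moreover have "map_poly \<phi> (P * S + R) = P' * map_poly \<phi> S + R'"
            by (simp add: mapadd[OF PS R(2) \<phi>] mapmult[OF P(1) R(1) \<phi>] P'_def R'_def)
          ultimately show ?thesis using R(4) by simp
        qed
        ultimately have "P' dvd R'"
          by (metis dvd_add_right_iff dvd_smult dvd_triv_left)
        then show False using R' by (auto dest: dvd_imp_degree_le)
      qed
      then obtain c where c: "poly P' c = 0" "poly f' c \<noteq> 0" by blast
      show "\<exists>\<psi>. hom_on (adjoin A b) \<psi> \<and> (\<forall>x\<in>A. \<psi> x = \<phi> x) \<and> \<psi> F \<noteq> 0"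
      proof (rule restr[OF \<phi> _ f c(2)[unfolded f'_def]])
        fix q assume q: "q \<in> polys_over A" "poly q b = 0"
        \<comment> \<open>By minimality of \<open>P\<close> the remainder \<open>T\<close> vanishes.
          Since \<phi> does not kill \<open>a\<close>, the root \<open>c\<close> of
          \<open>P'\<close> is then a root of the image of \<open>q\<close>.\<close>
        obtain N S T where T: "S \<in> polys_over A" "T \<in> polys_over A" "degree T < degree P"
          "smult (a ^ N) q = P * S + T"
          using polys_over_pseudo_divide[OF A P(1) degP q(1)] by (auto simp: a_def)
        have "poly T b = 0"
          using arg_cong[OF T(4), of "\<lambda>p. poly p b"] P q by simp
        then have "T = 0" using min[OF T(2)] T(3) by auto
        moreover have "map_poly \<phi> (smult (a ^ N) q) = smult (\<phi> a ^ N) (map_poly \<phi> q)"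
          using a by (simp add: mapsmult[OF q(1) _ \<phi>] subring_power[OF A] hom_power[OF A \<phi>])
        moreover have "map_poly \<phi> (P * S) = P' * map_poly \<phi> S"
          by (simp add: mapmult[OF P(1) T(1) \<phi>] P'_def)
        ultimately have "smult (\<phi> a ^ N) (map_poly \<phi> q) = P' * map_poly \<phi> S"
          using T(4) by simp
        from arg_cong[OF this, of "\<lambda>p. poly p c"] show "poly (map_poly \<phi> q) c = 0"
          using c \<phi>a by simp
      qed
    qed
  qed
qed

fun adjoin_list :: "'a::comm_ring_1 set \<Rightarrow> 'a list \<Rightarrow> 'a set" where
  "adjoin_list A [] = A"
| "adjoin_list A (b # bs) = adjoin_list (adjoin A b) bs"

lemma subring_adjoin_list: "subring_set A \<Longrightarrow> subring_set (adjoin_list A bs)"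
  by (induction bs arbitrary: A) (auto simp: subring_adjoin)

lemma subset_adjoin_list:
  assumes "subring_set A" shows "A \<union> set bs \<subseteq> adjoin_list A bs"
  using assms
proof (induction bs arbitrary: A)
  case (Cons b bs)
  then show ?case
    using subset_adjoin[OF Cons.prems, of b] mem_adjoin[OF Cons.prems, of b]
      Cons.IH[OF subring_adjoin[OF Cons.prems, of b]]
    by auto
qed simp

lemma adjoin_subset:
  assumes D: "subring_set D" "A \<subseteq> D" "b \<in> D"
  shows "adjoin A b \<subseteq> D"
proof
  fix x assume "x \<in> adjoin A b"
  then obtain p where p: "p \<in> polys_over A" "x = poly p b"
    unfolding adjoin_def by blast
  then have "coeff p i \<in> D" for i using D by (auto simp: polys_over_def)
  then show "x \<in> D"
    unfolding p(2) poly_altdef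
    by (intro subring_sum[OF D(1)] subring_mult[OF D(1)] subring_power[OF D(1)] D(3))
qed

text \<open>The element that must survive is passed backwards: the \<open>g\<close> found for the
  later generators is the \<open>F\<close> of the first one. The domain \<open>D\<close> stays fixed
  while \<open>A\<close> grows.\<close>

lemma extend_hom_adjoin_list:
  assumes "subring_set A" and D: "subring_set D" "A \<subseteq> D" "set bs \<subseteq> D"
    and nzd: "\<And>x y. x \<in> D \<Longrightarrow> y \<in> D \<Longrightarrow> x * y = 0 \<Longrightarrow> x = 0 \<or> y = 0"
    and "F \<in> adjoin_list A bs" "F \<noteq> 0"
  shows "\<exists>g\<in>A. g \<noteq> 0 \<and> (\<forall>\<phi>. hom_on A \<phi> \<longrightarrow> \<phi> g \<noteq> 0 \<longrightarrow>
           (\<exists>\<psi>. hom_on (adjoin_list A bs) \<psi> \<and> (\<forall>x\<in>A. \<psi> x = \<phi> x) \<and> \<psi> F \<noteq> 0))"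
  using assms
proof (induction bs arbitrary: A)
  case Nil
  then show ?case by auto
next
  case (Cons b bs)
  have b: "b \<in> D" using Cons.prems by auto
  obtain g where g: "g \<in> adjoin A b" "g \<noteq> 0"
    and ext: "\<And>\<phi>. hom_on (adjoin A b) \<phi> \<Longrightarrow> \<phi> g \<noteq> 0 \<Longrightarrow>
      \<exists>\<psi>. hom_on (adjoin_list (adjoin A b) bs) \<psi> \<and> (\<forall>x\<in>adjoin A b. \<psi> x = \<phi> x) \<and> \<psi> F \<noteq> 0"
    using Cons.IH[OF subring_adjoin[OF Cons.prems(1)] D(1) adjoin_subset[OF D(1) Cons.prems(3) b]]
      Cons.prems by auto
  obtain h where h: "h \<in> A" "h \<noteq> 0"
    and ext': "\<And>\<phi>. hom_on A \<phi> \<Longrightarrow> \<phi> h \<noteq> 0 \<Longrightarrow>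
      \<exists>\<psi>. hom_on (adjoin A b) \<psi> \<and> (\<forall>x\<in>A. \<psi> x = \<phi> x) \<and> \<psi> g \<noteq> 0"
    using extend_hom_adjoin[OF Cons.prems(1) D(1) Cons.prems(3) b nzd g] by blast
  have "\<exists>\<psi>. hom_on (adjoin_list A (b # bs)) \<psi> \<and> (\<forall>x\<in>A. \<psi> x = \<phi> x) \<and> \<psi> F \<noteq> 0"
    if \<phi>: "hom_on A \<phi>" "\<phi> h \<noteq> 0" for \<phi>
  proof -
    obtain \<chi> where \<chi>: "hom_on (adjoin A b) \<chi>" "\<forall>x\<in>A. \<chi> x = \<phi> x" "\<chi> g \<noteq> 0"
      using ext'[OF \<phi>] by blast
    obtain \<psi> where "hom_on (adjoin_list (adjoin A b) bs) \<psi>"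
      "\<forall>x\<in>adjoin A b. \<psi> x = \<chi> x" "\<psi> F \<noteq> 0"
      using ext[OF \<chi>(1,3)] by blast
    with \<chi> subset_adjoin[OF Cons.prems(1), of b] show ?thesis
      by (intro exI[of _ \<psi>]) auto
  qed
  with h show ?case by blast
qed

section \<open>Images of dominant polynomial maps\<close>

lemma subring_set_polyfun: "subring_set {f. polyfun I f}"
proof -
  have "f - g = (\<lambda>x. f x - g x)" for f g :: "('a \<Rightarrow> 'b) \<Rightarrow> 'b"
    by (rule ext) simp
  then show ?thesis
    by (auto simp: subring_set_def one_fun_def times_fun_def
        intro: polyfun.intros polyfun_diff)
qed

text \<open>Points are homomorphisms: a target point \<open>X\<close> is evaluation at
  \<open>X\<close> on the ring \<open>A\<close> of pulled back functions. An extension to the ring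
  generated by the parameter coordinates is evaluation at a point \<open>t\<close> above
  \<open>X\<close>.\<close>

theorem dominant_image_contains_open:
  fixes \<Phi> :: "('t \<Rightarrow> complex) \<Rightarrow> 'j \<Rightarrow> complex" and F :: "('t \<Rightarrow> complex) \<Rightarrow> complex"
  assumes "finite V" and \<Phi>: "\<And>j. j \<in> J \<Longrightarrow> polyfun V (\<lambda>t. \<Phi> t j)"
    and dominant: "\<And>P. polyfun J P \<Longrightarrow> (\<And>t. P (\<Phi> t) = 0) \<Longrightarrow> P = 0"
    and F: "polyfun V F" "F \<noteq> 0"
  shows "\<exists>G. polyfun J G \<and> G \<noteq> 0 \<and> (\<forall>X. G X \<noteq> 0 \<longrightarrow> (\<exists>t. F t \<noteq> 0 \<and> (\<forall>j\<in>J. \<Phi> t j = X j)))"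
proof -
  define D where "D = {f :: ('t \<Rightarrow> complex) \<Rightarrow> complex. polyfun V f}"
  define A where "A = (\<lambda>P t. P (\<Phi> t)) ` {P. polyfun J P}"
  have compA: "(\<lambda>t. P (\<Phi> t)) \<in> A" if "polyfun J P" for P
    using that by (auto simp: A_def)
  have D: "subring_set D"
    unfolding D_def by (rule subring_set_polyfun)
  have A: "subring_set A"
    unfolding subring_set_def
  proof (intro conjI ballI)
    show "1 \<in> A"
      using compA[OF polyfun.const[of J 1]] by (simp add: one_fun_def)
  next
    fix f g assume "f \<in> A" "g \<in> A"
    then obtain P Q where PQ: "polyfun J P" "polyfun J Q" "f = (\<lambda>t. P (\<Phi> t))" "g = (\<lambda>t. Q (\<Phi> t))"
      unfolding A_def by blast
    have "f - g = (\<lambda>t. P (\<Phi> t) - Q (\<Phi> t))" "f * g = (\<lambda>t. P (\<Phi> t) * Q (\<Phi> t))"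
      by (auto simp: PQ fun_eq_iff)
    then show "f - g \<in> A" "f * g \<in> A"
      using compA[OF polyfun_diff[OF PQ(1,2)]] compA[OF polyfun.mult[OF PQ(1,2)]] by auto
  qed
  have AD: "A \<subseteq> D"
    unfolding A_def D_def using polyfun_compose[of J _ V \<Phi>, OF _ \<Phi>] by blast
  obtain vs where vs: "set vs = V"
    using \<open>finite V\<close> finite_list by blast
  define bs :: "(('t \<Rightarrow> complex) \<Rightarrow> complex) list" where "bs = map (\<lambda>v t. t v) vs"
  have bs: "set bs \<subseteq> D"
    by (auto simp: bs_def vs D_def intro: polyfun.intros)
  define B where "B = adjoin_list A bs"
  have B: "subring_set B" "A \<subseteq> B" "set bs \<subseteq> B"
    unfolding B_def using subring_adjoin_list[OF A] subset_adjoin_list[OF A, of bs] by auto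
  have constB: "(\<lambda>_. c) \<in> A" for c
    using compA[OF polyfun.const] .
  have coordB: "(\<lambda>t. t v) \<in> B" if "v \<in> V" for v
    using that B(3) by (auto simp: bs_def vs)
  have DB: "f \<in> B" if "polyfun V f" for f
    using that
  proof (induction rule: polyfun.induct)
    case (const c)
    then show ?case using constB B by blast
  next
    case (coord v)
    then show ?case by (rule coordB)
  next
    case (add f g)
    then show ?case using subring_add[OF B(1)] by (simp add: plus_fun_def)
  next
    case (mult f g)
    then show ?case using subring_mult[OF B(1)] by (simp add: times_fun_def)
  qed
  have nzd: "x = 0 \<or> y = 0" if "x \<in> D" "y \<in> D" "x * y = 0" for x y
    using that polyfun_mult_eq_0 by (auto simp: D_def)
  obtain g where g: "g \<in> A" "g \<noteq> 0"
    and ext: "\<And>\<phi>. hom_on A \<phi> \<Longrightarrow> \<phi> g \<noteq> 0 \<Longrightarrow>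
      \<exists>\<psi>. hom_on B \<psi> \<and> (\<forall>x\<in>A. \<psi> x = \<phi> x) \<and> \<psi> F \<noteq> 0"
    using extend_hom_adjoin_list[OF A D AD bs nzd] DB[OF F(1)] F(2) unfolding B_def by blast
  obtain G where G: "polyfun J G" "g = (\<lambda>t. G (\<Phi> t))"
    using g(1) unfolding A_def by blast
  have "\<exists>t. F t \<noteq> 0 \<and> (\<forall>j\<in>J. \<Phi> t j = X j)" if X: "G X \<noteq> 0" for X
  proof -
    \<comment> \<open>Evaluation at \<open>X\<close> makes sense on \<open>A\<close> because
      dominance makes pulling back injective, so the choice of \<open>P\<close> is
      immaterial.\<close>
    define \<phi> where "\<phi> = (\<lambda>f. (SOME P. polyfun J P \<and> f = (\<lambda>t. P (\<Phi> t))) X)"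
    have \<phi>: "\<phi> (\<lambda>t. P (\<Phi> t)) = P X" if P: "polyfun J P" for P
    proof -
      define Q where "Q = (SOME Q. polyfun J Q \<and> (\<lambda>t. P (\<Phi> t)) = (\<lambda>t. Q (\<Phi> t)))"
      have Q: "polyfun J Q \<and> (\<lambda>t. P (\<Phi> t)) = (\<lambda>t. Q (\<Phi> t))"
        unfolding Q_def by (rule someI[of _ P]) (use P in simp)
      have "(\<lambda>x. P x - Q x) = 0"
      proof (rule dominant)
        show "polyfun J (\<lambda>x. P x - Q x)" using P Q polyfun_diff by blast
        show "P (\<Phi> t) - Q (\<Phi> t) = 0" for t using Q by (metis right_minus_eq)
      qed
      from fun_cong[OF this, of X] show ?thesis
        by (simp add: \<phi>_def Q_def)
    qed
    have "hom_on A \<phi>"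
      unfolding hom_on_def
    proof (intro conjI ballI)
      show "\<phi> 1 = 1"
        using \<phi>[OF polyfun.const[of J 1]] by (simp add: one_fun_def)
    next
      fix f g assume "f \<in> A" "g \<in> A"
      then obtain P Q where PQ: "polyfun J P" "polyfun J Q" "f = (\<lambda>t. P (\<Phi> t))" "g = (\<lambda>t. Q (\<Phi> t))"
        unfolding A_def by blast
      have "f - g = (\<lambda>t. P (\<Phi> t) - Q (\<Phi> t))" "f * g = (\<lambda>t. P (\<Phi> t) * Q (\<Phi> t))"
        by (auto simp: PQ fun_eq_iff)
      then show "\<phi> (f - g) = \<phi> f - \<phi> g" "\<phi> (f * g) = \<phi> f * \<phi> g"
        using \<phi>[OF polyfun_diff[OF PQ(1,2)]] \<phi>[OF polyfun.mult[OF PQ(1,2)]] \<phi>[OF PQ(1)] \<phi>[OF PQ(2)]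
        by (simp_all add: PQ(3,4))
    qed
    moreover have "\<phi> g \<noteq> 0"
      using \<phi>[OF G(1)] X by (simp add: G(2))
    ultimately obtain \<psi> where \<psi>: "hom_on B \<psi>" "\<And>x. x \<in> A \<Longrightarrow> \<psi> x = \<phi> x" "\<psi> F \<noteq> 0"
      using ext by blast
    \<comment> \<open>The point is read off from the images of the coordinate functions; since
      \<psi> fixes the constants, it is evaluation there.\<close>
    define t where "t = (\<lambda>v. \<psi> (\<lambda>t. t v))"
    have eval: "\<psi> f = f t" if "polyfun V f" for f
      using that
    proof (induction rule: polyfun.induct)
      case (const c)
      then show ?case using \<psi>(2)[OF constB] \<phi>[OF polyfun.const] by simp
    next
      case (coord v)
      then show ?case by (simp add: t_def)
    next
      case (add f g)
      then show ?case using hom_add[OF B(1) \<psi>(1)] DB by (simp add: plus_fun_def)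
    next
      case (mult f g)
      then show ?case using hom_mult[OF B(1) \<psi>(1)] DB by (simp add: times_fun_def)
    qed
    have "\<Phi> t j = X j" if j: "j \<in> J" for j
      using eval[OF \<Phi>[OF j]] \<psi>(2)[OF compA[OF polyfun.coord[OF j]]] \<phi>[OF polyfun.coord[OF j]]
      by simp
    then show ?thesis
      using eval[OF F(1)] \<psi>(3) by auto
  qed
  moreover have "G \<noteq> 0" using g G by auto
  ultimately show ?thesis using G by blast
qed

section \<open>Taylor expansion and the tangent criterion\<close>

lemma polyfun_homogeneous_parts:
  fixes P :: "('j \<Rightarrow> complex) \<Rightarrow> complex"
  assumes "polyfun J P"
  shows "\<exists>N H. (\<forall>r. polyfun J (H r)) \<and> (\<forall>r c y. H r (\<lambda>j. c * y j) = c ^ r * H r y) \<and>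
           (\<forall>y. P (\<lambda>j. a j + y j) = (\<Sum>r\<le>N. H r y))"
proof -
  \<comment> \<open>The induction also records that the parts beyond \<open>N\<close> vanish. This
    allows the bound to be raised for sums and Cauchy products to be formed for products.\<close>
  define hom where "hom = (\<lambda>N P H. (\<forall>r. polyfun J (H r)) \<and> (\<forall>r>N. H r = (\<lambda>_. 0)) \<and>
      (\<forall>r c y. H r (\<lambda>j. c * y j) = c ^ r * H r y) \<and>
      (\<forall>y. P (\<lambda>j. a j + y j) = (\<Sum>r\<le>(N::nat). H r (y :: 'j \<Rightarrow> complex))))"
  have mono: "hom M P H" if "hom N P H" "N \<le> M" for N M H P
  proof -
    have "(\<Sum>r\<le>M. H r y) = (\<Sum>r\<le>N. H r y)" for y
      by (rule sum.mono_neutral_right) (use that in \<open>auto simp: hom_def\<close>)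
    then show ?thesis using that by (simp add: hom_def)
  qed
  have "\<exists>N H. hom N P H"
    using assms
  proof (induction rule: polyfun.induct)
    case (const c)
    have "hom 0 (\<lambda>_. c) (\<lambda>r y. if r = 0 then c else 0)"
      by (auto simp: hom_def intro: polyfun.const)
    then show ?case by blast
  next
    case (coord j)
    have "hom 1 (\<lambda>x. x j) (\<lambda>r y. if r = 0 then a j else if r = 1 then y j else 0)"
      unfolding hom_def
    proof (intro conjI allI impI)
      fix r show "polyfun J (\<lambda>y. if r = 0 then a j else if r = 1 then y j else 0)"
        using coord by (cases "r = 0"; cases "r = 1") (simp_all add: polyfun.const polyfun.coord)
    qed auto
    then show ?case by blast
  next
    case (add f g)
    then obtain N M H K where "hom N f H" "hom M g K" by blast
    then have H: "hom (max N M) f H" "hom (max N M) g K"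
      using mono by (meson max.cobounded1 max.cobounded2)+
    then have "hom (max N M) (\<lambda>x. f x + g x) (\<lambda>r y. H r y + K r y)"
      by (simp add: hom_def polyfun.add sum.distrib algebra_simps)
    then show ?case by blast
  next
    case (mult f g)
    then obtain N M H K where HK: "hom N f H" "hom M g K" by blast
    define L where "L = (\<lambda>r y. \<Sum>i\<le>r. H i y * K (r - i) y)"
    have "hom (N + M) (\<lambda>x. f x * g x) L"
      unfolding hom_def
    proof (intro conjI allI impI)
      fix r show "polyfun J (L r)"
        unfolding L_def using HK by (intro polyfun_sum polyfun.mult) (auto simp: hom_def)
    next
      fix r assume r: "r > N + M"
      have "H i y * K (r - i) y = 0" if "i \<le> r" for i y
      proof (cases "i > N")
        case True
        then show ?thesis using HK by (simp add: hom_def)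
      next
        case False
        then have "r - i > M" using r by simp
        then show ?thesis using HK by (simp add: hom_def)
      qed
      then show "L r = (\<lambda>_. 0)" by (simp only: L_def fun_eq_iff) (simp add: sum.neutral)
    next
      fix r c y
      have "H i (\<lambda>j. c * y j) * K (r - i) (\<lambda>j. c * y j) = c ^ r * (H i y * K (r - i) y)"
        if "i \<le> r" for i
      proof -
        have "c ^ r = c ^ i * c ^ (r - i)" using that by (simp flip: power_add)
        then show ?thesis using HK by (simp add: hom_def)
      qed
      then show "L r (\<lambda>j. c * y j) = c ^ r * L r y"
        by (simp add: L_def sum_distrib_left)
    next
      fix y
      have "f (\<lambda>j. a j + y j) * g (\<lambda>j. a j + y j) = (\<Sum>i\<le>N. H i y) * (\<Sum>i\<le>M. K i y)"
        using HK by (simp add: hom_def)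
      \<comment> \<open>This is multiplication of univariate polynomials, evaluated at 1.\<close>
      also have "\<dots> = (\<Sum>r\<le>N + M. \<Sum>i\<le>r. H i y * K (r - i) y)"
        using HK using polynomial_product[of N "\<lambda>i. H i y" M "\<lambda>i. K i y" 1] by (simp add: hom_def)
      finally show "f (\<lambda>j. a j + y j) * g (\<lambda>j. a j + y j) = (\<Sum>r\<le>N + M. L r y)"
        by (simp add: L_def)
    qed
    then show ?case by blast
  qed
  then show ?thesis unfolding hom_def by blast
qed

lemma polyfun_tendsto:
  fixes Q :: "('j \<Rightarrow> complex) \<Rightarrow> complex"
  assumes "polyfun J Q" "\<And>j. j \<in> J \<Longrightarrow> ((\<lambda>s. u s j) \<longlongrightarrow> w j) F"
  shows "((\<lambda>s. Q (u s)) \<longlongrightarrow> Q w) F"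
  using assms by (induction rule: polyfun.induct) (auto intro!: tendsto_intros)

text \<open>
  The lowest nonvanishing homogeneous part of \<open>P\<close> at \<open>a\<close> vanishes at every tangent vector.
\<close>

lemma polyfun_eq_0_if_all_tangents:
  fixes P :: "('j \<Rightarrow> complex) \<Rightarrow> complex"
  assumes P: "polyfun J P"
    and curve: "\<And>w. \<exists>\<gamma>. (\<forall>s. P (\<gamma> s) = 0) \<and>
      (\<forall>j\<in>J. \<gamma> 0 j = a j \<and> ((\<lambda>s. \<gamma> s j) has_field_derivative w j) (at 0))"
  shows "P = 0"
proof (rule ccontr)
  assume "P \<noteq> 0"
  then obtain x where x: "P x \<noteq> 0" by (auto simp: fun_eq_iff)
  obtain N H where H: "\<And>r. polyfun J (H r)" "\<And>r c y. H r (\<lambda>j. c * y j) = c ^ r * H r y"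
    "\<And>y. P (\<lambda>j. a j + y j) = (\<Sum>r\<le>N. H r y)"
    using polyfun_homogeneous_parts[OF P, of a] by blast
  \<comment> \<open>\<open>r\<close> is the order of vanishing at \<open>a\<close>; the tangent
    vector \<open>w\<close> is then chosen so that the lowest part does not vanish there.\<close>
  define r where "r = (LEAST r. \<exists>y. H r y \<noteq> 0)"
  have ex: "\<exists>r\<le>N. \<exists>y. H r y \<noteq> 0"
  proof (rule ccontr)
    assume "\<not> ?thesis"
    then have "P (\<lambda>j. a j + (x j - a j)) = 0" unfolding H(3) by simp
    then show False using x by simp
  qed
  then have "\<exists>r y. H r y \<noteq> 0" by blast
  from LeastI_ex[OF this] obtain w where w: "H r w \<noteq> 0"
    unfolding r_def by blast
  have "r \<le> N"
    unfolding r_def using ex by (blast intro: Least_le order_trans)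
  have low: "H q y = 0" if "q < r" for q y
    using not_less_Least[OF that[unfolded r_def]] by simp
  obtain \<gamma> where \<gamma>: "\<And>s. P (\<gamma> s) = 0" "\<And>j. j \<in> J \<Longrightarrow> \<gamma> 0 j = a j"
    "\<And>j. j \<in> J \<Longrightarrow> ((\<lambda>s. \<gamma> s j) has_field_derivative w j) (at 0)"
    using curve[of w] by blast
  define u where "u = (\<lambda>s j. (\<gamma> s j - a j) / s)"
  have u: "((\<lambda>s. u s j) \<longlongrightarrow> w j) (at 0)" if "j \<in> J" for j
    using \<gamma>(3)[OF that] \<gamma>(2)[OF that] by (simp add: has_field_derivative_iff u_def)
  \<comment> \<open>\<open>K s\<close> is \<open>P (\<gamma> s)\<close> divided by
    \<open>s ^ r\<close>. As \<open>s\<close> tends to 0, the difference quotients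
    \<open>u s\<close> tend to \<open>w\<close> and only the term \<open>q = r\<close> survives, as
    \<open>0 ^ 0 = 1\<close>.\<close>
  define K where "K = (\<lambda>s. \<Sum>q\<in>{r..N}. s ^ (q - r) * H q (u s))"
  have K: "K s = 0" if s: "s \<noteq> 0" for s
  proof -
    have "0 = P (\<lambda>j. a j + s * u s j)"
      using polyfun_cong[OF P, of "\<gamma> s" "\<lambda>j. a j + s * u s j"] \<gamma>(1)[of s] s by (simp add: u_def)
    also have "\<dots> = (\<Sum>q\<le>N. s ^ q * H q (u s))"
      by (simp add: H(3)[of "\<lambda>j. s * u s j"] H(2))
    also have "\<dots> = (\<Sum>q\<in>{r..N}. s ^ q * H q (u s))"
      by (rule sum.mono_neutral_right) (auto simp: low)
    also have "\<dots> = s ^ r * K s"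
      unfolding K_def sum_distrib_left by (rule sum.cong) (auto simp flip: power_add mult.assoc)
    finally show ?thesis using s by simp
  qed
  have "(K \<longlongrightarrow> (\<Sum>q\<in>{r..N}. 0 ^ (q - r) * H q w)) (at 0)"
    unfolding K_def by (intro tendsto_intros polyfun_tendsto[OF H(1)] u)
  moreover have "(K \<longlongrightarrow> 0) (at 0)"
    by (rule tendsto_eventually) (auto simp: eventually_at_filter K)
  ultimately have "(\<Sum>q\<in>{r..N}. 0 ^ (q - r) * H q w) = 0"
    by (rule tendsto_unique[rotated]) simp
  moreover have "(\<Sum>q\<in>{r..N}. 0 ^ (q - r) * H q w) = (\<Sum>q\<in>{r}. 0 ^ (q - r) * H q w)"
    using \<open>r \<le> N\<close> by (intro sum.mono_neutral_right) auto
  ultimately show False using w by simp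
qed

section \<open>Generic real points\<close>

definition monom_eval :: "('i \<Rightarrow>\<^sub>0 nat) \<Rightarrow> ('i \<Rightarrow> 'a::comm_semiring_1) \<Rightarrow> 'a" where
  "monom_eval m x = (\<Prod>i\<in>Poly_Mapping.keys m. x i ^ Poly_Mapping.lookup m i)"

text \<open>Missing variables have exponent 0, so monomials with different supports can be evaluated
  over a common index set.\<close>

lemma monom_eval_superset:
  assumes "finite S" "Poly_Mapping.keys m \<subseteq> S"
  shows "monom_eval m x = (\<Prod>i\<in>S. x i ^ Poly_Mapping.lookup m i)"
  unfolding monom_eval_def
  by (rule prod.mono_neutral_left) (use assms in \<open>auto simp: in_keys_iff\<close>)

lemma monom_eval_add: "monom_eval (m + m') x = monom_eval m x * monom_eval m' x"
proof -
  define S where "S = Poly_Mapping.keys m \<union> Poly_Mapping.keys m'"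
  have "finite S" "Poly_Mapping.keys m \<subseteq> S" "Poly_Mapping.keys m' \<subseteq> S" "Poly_Mapping.keys (m + m') \<subseteq> S"
    using Poly_Mapping.keys_add[of m m'] by (auto simp: S_def)
  then show ?thesis
    by (simp add: monom_eval_superset[of S] prod.distrib lookup_add power_add)
qed

lemma mpoly_eval_superset:
  assumes "finite S" "Poly_Mapping.keys f \<subseteq> S"
  shows "mpoly_eval f x = (\<Sum>m\<in>S. Poly_Mapping.lookup f m * monom_eval m x)"
  unfolding mpoly_eval_def monom_eval_def
  by (rule sum.mono_neutral_left) (use assms in \<open>auto simp: in_keys_iff\<close>)

lemma mpoly_eval_add: "mpoly_eval (f + g) x = mpoly_eval f x + mpoly_eval g x"
proof -
  define S where "S = Poly_Mapping.keys f \<union> Poly_Mapping.keys g"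
  have "finite S" "Poly_Mapping.keys f \<subseteq> S" "Poly_Mapping.keys g \<subseteq> S" "Poly_Mapping.keys (f + g) \<subseteq> S"
    using Poly_Mapping.keys_add[of f g] by (auto simp: S_def)
  then show ?thesis
    by (simp add: mpoly_eval_superset[of S] sum.distrib lookup_add algebra_simps)
qed

lemma mpoly_eval_single: "mpoly_eval (Poly_Mapping.single m c) x = c * monom_eval m x"
  by (subst mpoly_eval_superset[of "{m}"]) auto

lemma mpoly_eval_zero: "mpoly_eval 0 x = 0"
  by (simp add: mpoly_eval_def)

lemma mpoly_eval_sum: "mpoly_eval (\<Sum>a\<in>A. f a) x = (\<Sum>a\<in>A. mpoly_eval (f a) x)"
  by (induction A rule: infinite_finite_induct) (auto simp: mpoly_eval_add mpoly_eval_zero)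

lemma poly_mapping_eq_sum_single:
  "f = (\<Sum>m\<in>Poly_Mapping.keys f. Poly_Mapping.single m (Poly_Mapping.lookup f m))"
proof (rule poly_mapping_eqI)
  fix k
  show "Poly_Mapping.lookup f k =
      Poly_Mapping.lookup (\<Sum>m\<in>Poly_Mapping.keys f. Poly_Mapping.single m (Poly_Mapping.lookup f m)) k"
    by (cases "k \<in> Poly_Mapping.keys f")
      (auto simp: lookup_sum lookup_single when_def in_keys_iff)
qed

lemma mpoly_eval_mult: "mpoly_eval (f * g) x = mpoly_eval f x * mpoly_eval g x"
proof -
  let ?t = "\<lambda>f m. Poly_Mapping.single m (Poly_Mapping.lookup f m)"
  have "f * g = (\<Sum>m\<in>Poly_Mapping.keys f. \<Sum>m'\<in>Poly_Mapping.keys g. ?t f m * ?t g m')"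
    by (subst poly_mapping_eq_sum_single[of f], subst poly_mapping_eq_sum_single[of g])
      (rule sum_product)
  then have "mpoly_eval (f * g) x = (\<Sum>m\<in>Poly_Mapping.keys f. \<Sum>m'\<in>Poly_Mapping.keys g.
      (Poly_Mapping.lookup f m * monom_eval m x) * (Poly_Mapping.lookup g m' * monom_eval m' x))"
    by (simp add: mpoly_eval_sum mult_single mpoly_eval_single monom_eval_add mult_ac)
  then show ?thesis
    by (simp add: mpoly_eval_def monom_eval_def sum_product)
qed

lemma polyfun_imp_mpoly:
  assumes "polyfun I f"
  shows "\<exists>p. mpoly_vars p \<subseteq> I \<and> (\<forall>x. mpoly_eval p x = f x)"
  using assms
proof (induction rule: polyfun.induct)
  case (const c)
  show ?case
    by (rule exI[of _ "Poly_Mapping.single 0 c"])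
      (auto simp: mpoly_vars_def mpoly_eval_single monom_eval_def split: if_splits)
next
  case (coord i)
  then show ?case
    by (intro exI[of _ "Poly_Mapping.single (Poly_Mapping.single i 1) 1"])
      (auto simp: mpoly_vars_def mpoly_eval_single monom_eval_def)
next
  case (add f g)
  then obtain p q where pq: "mpoly_vars p \<subseteq> I" "mpoly_vars q \<subseteq> I"
    "\<And>x. mpoly_eval p x = f x" "\<And>x. mpoly_eval q x = g x" by blast
  have "mpoly_vars (p + q) \<subseteq> mpoly_vars p \<union> mpoly_vars q"
    unfolding mpoly_vars_def using Poly_Mapping.keys_add[of p q] by blast
  with pq show ?case
    by (intro exI[of _ "p + q"]) (auto simp: mpoly_eval_add)
next
  case (mult f g)
  then obtain p q where pq: "mpoly_vars p \<subseteq> I" "mpoly_vars q \<subseteq> I"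
    "\<And>x. mpoly_eval p x = f x" "\<And>x. mpoly_eval q x = g x" by blast
  have "mpoly_vars (p * q) \<subseteq> mpoly_vars p \<union> mpoly_vars q"
  proof
    fix i assume "i \<in> mpoly_vars (p * q)"
    then obtain m m' where "m \<in> Poly_Mapping.keys p" "m' \<in> Poly_Mapping.keys q"
      "i \<in> Poly_Mapping.keys (m + m')"
      using keys_mult[of p q] by (auto simp: mpoly_vars_def)
    then show "i \<in> mpoly_vars p \<union> mpoly_vars q"
      using Poly_Mapping.keys_add[of m m'] by (auto simp: mpoly_vars_def)
  qed
  with pq show ?case
    by (intro exI[of _ "p * q"]) (auto simp: mpoly_eval_mult)
qed

text \<open>On the line through \<open>Re z\<close> with direction \<open>Im z\<close>, the
  parameter \<i> gives \<open>z\<close>. The restriction of \<open>G\<close> is thus a nonzero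
  polynomial and has only finitely many real roots.\<close>

lemma polyfun_nonzero_at_real_point:
  fixes G :: "('i \<Rightarrow> complex) \<Rightarrow> complex"
  assumes "polyfun I G" "G z \<noteq> 0"
  shows "\<exists>x :: 'i \<Rightarrow> real. G (\<lambda>i. complex_of_real (x i)) \<noteq> 0"
proof -
  obtain p where p: "\<And>s. G (\<lambda>i. of_real (Re (z i)) + s * of_real (Im (z i))) = poly p s"
    using polyfun_on_line[OF assms(1), of "\<lambda>i. of_real (Re (z i))" "\<lambda>i. of_real (Im (z i))"] by blast
  have "poly p \<i> \<noteq> 0"
    using assms(2) by (simp flip: p complex_eq)
  then have "finite {s. poly p s = 0}"
    by (intro poly_roots_finite) auto
  moreover have "infinite (range complex_of_real)"
    using infinite_UNIV_char_0[where 'a = real] by (simp add: finite_image_iff inj_def)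
  ultimately obtain s where "poly p (complex_of_real s) \<noteq> 0"
    by (metis (mono_tags, lifting) finite_subset image_subsetI mem_Collect_eq)
  then show ?thesis
    by (intro exI[of _ "\<lambda>i. Re (z i) + s * Im (z i)"]) (simp flip: p)
qed

text \<open>Genericity of games refers to real polynomials, so a complex nonvanishing condition is
  split into two real ones.\<close>

lemma polyfun_real_imag_parts:
  fixes G :: "('i \<Rightarrow> complex) \<Rightarrow> complex"
  assumes "polyfun I G"
  shows "\<exists>f g. polyfun I f \<and> polyfun I g \<and>
    (\<forall>x. G (\<lambda>i. complex_of_real (x i)) = Complex (f x) (g x))"
  using assms
proof (induction rule: polyfun.induct)
  case (const c)
  show ?case
    by (rule exI[of _ "\<lambda>_. Re c"], rule exI[of _ "\<lambda>_. Im c"]) (auto intro: polyfun.const)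
next
  case (coord i)
  show ?case
    by (rule exI[of _ "\<lambda>x. x i"], rule exI[of _ "\<lambda>_. 0"])
      (auto intro: coord polyfun.intros simp: complex_of_real_def)
next
  case (add G H)
  then obtain f g f' g' where fg: "polyfun I f" "polyfun I g" "polyfun I f'" "polyfun I g'"
    "\<And>x. G (\<lambda>i. complex_of_real (x i)) = Complex (f x) (g x)"
    "\<And>x. H (\<lambda>i. complex_of_real (x i)) = Complex (f' x) (g' x)" by blast
  show ?case
    by (rule exI[of _ "\<lambda>x. f x + f' x"], rule exI[of _ "\<lambda>x. g x + g' x"]) (auto intro: polyfun.intros simp: fg complex_add)
next
  case (mult G H)
  then obtain f g f' g' where fg: "polyfun I f" "polyfun I g" "polyfun I f'" "polyfun I g'"
    "\<And>x. G (\<lambda>i. complex_of_real (x i)) = Complex (f x) (g x)"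
    "\<And>x. H (\<lambda>i. complex_of_real (x i)) = Complex (f' x) (g' x)" by blast
  show ?case
    by (rule exI[of _ "\<lambda>x. f x * f' x - g x * g' x"], rule exI[of _ "\<lambda>x. f x * g' x + g x * f' x"])
      (auto intro!: polyfun_diff polyfun.add polyfun.mult fg(1-4) simp: fg(5,6) complex_mult)
qed

lemma generic_if_complex_polyfun:
  fixes G :: "('i \<Rightarrow> complex) \<Rightarrow> complex"
  assumes G: "polyfun I G" "G \<noteq> 0"
    and Q: "\<And>x :: 'i \<Rightarrow> real. G (\<lambda>i. complex_of_real (x i)) \<noteq> 0 \<Longrightarrow> Q x"
  shows "generic I Q"
proof -
  obtain f g where fg: "polyfun I f" "polyfun I g"
    "\<And>x. G (\<lambda>i. complex_of_real (x i)) = Complex (f x) (g x)"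
    using polyfun_real_imag_parts[OF G(1)] by blast
  obtain p q where pq: "mpoly_vars p \<subseteq> I" "mpoly_vars q \<subseteq> I"
    "\<And>x. mpoly_eval p x = f x" "\<And>x. mpoly_eval q x = g x"
    using fg polyfun_imp_mpoly by meson
  obtain z where "G z \<noteq> 0" using G(2) by (auto simp: fun_eq_iff)
  then obtain x :: "'i \<Rightarrow> real" where "G (\<lambda>i. complex_of_real (x i)) \<noteq> 0"
    using polyfun_nonzero_at_real_point[OF G(1)] by blast
  \<comment> \<open>Points of affine space are undefined off \<open>I\<close>, hence the
    restriction.\<close>
  then have x: "f (restrict x I) \<noteq> 0 \<or> g (restrict x I) \<noteq> 0"
    using polyfun_cong[OF fg(1), of x "restrict x I"] polyfun_cong[OF fg(2), of x "restrict x I"]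
    by (auto simp: fg(3) complex_eq_iff)
  define U where "U = {x \<in> I \<rightarrow>\<^sub>E UNIV. \<exists>r\<in>{p, q}. mpoly_eval r x \<noteq> 0}"
  have "zariski_open I U"
    unfolding zariski_open_def U_def using pq(1,2) by (intro exI[of _ "{p, q}"]) auto
  moreover have "restrict x I \<in> U"
    using x by (simp add: U_def pq)
  moreover have "Q y" if "y \<in> U" for y
    by (rule Q) (use that in \<open>auto simp: U_def pq fg(3) complex_eq_iff\<close>)
  ultimately show ?thesis unfolding generic_def by blast
qed

section \<open>Spohn CI varieties\<close>

text \<open>
  To insert a player \<open>k\<close>, send \<open>(k, i)\<close> to \<open>(M, i)\<close> and redirect the former preimage of \<open>(M, i)\<close>
  to \<open>(k, i)\<close>; this is where \<open>d k \<le> d M\<close> is needed.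
\<close>

lemma deviation_matching:
  fixes d :: "nat \<Rightarrow> nat"
  assumes "finite K" "M \<notin> K" "M' \<notin> K" "M \<noteq> M'" "\<forall>k\<in>insert M' K. d k \<le> d M"
  shows "\<exists>\<pi>. inj_on \<pi> (SIGMA k:insert M' K. {2..d k}) \<and>
    (\<forall>k\<in>insert M' K. \<forall>i\<in>{2..d k}. \<exists>l\<in>insert M K. \<exists>a\<in>{2..d l}. \<pi> (k, i) = (l, a) \<and> l \<noteq> k)"
  using assms
proof (induction K rule: finite_induct)
  case empty
  \<comment> \<open>Without further players, strategy \<open>i\<close> of \<open>M'\<close> is
    matched with strategy \<open>i\<close> of \<open>M\<close>.\<close>
  then show ?case
    by (intro exI[of _ "\<lambda>(k, i). (M, i)"]) (auto simp: inj_on_def)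
next
  case (insert k K)
  have prems: "M \<notin> K" "M' \<notin> K" "\<forall>k\<in>insert M' K. d k \<le> d M"
    using insert.prems by auto
  obtain \<pi> where inj: "inj_on \<pi> (SIGMA k:insert M' K. {2..d k})"
    and \<pi>: "\<And>k i. k \<in> insert M' K \<Longrightarrow> i \<in> {2..d k} \<Longrightarrow>
      \<exists>l\<in>insert M K. \<exists>a\<in>{2..d l}. \<pi> (k, i) = (l, a) \<and> l \<noteq> k"
    using insert.IH[OF prems(1,2) \<open>M \<noteq> M'\<close> prems(3)] by blast
  define \<rho> where "\<rho> = (\<lambda>(l, a). if l = M \<and> a \<le> d k then (k, a) else (l, a))"
  define \<pi>' where "\<pi>' = (\<lambda>(l, i). if l = k then (M, i) else \<rho> (\<pi> (l, i)))"
  have \<rho>: "inj_on \<rho> (insert M K \<times> UNIV)"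
    using insert by (auto simp: inj_on_def \<rho>_def split: if_splits)
  have \<rho>M: "\<rho> r \<noteq> (M, i)" if "i \<le> d k" for r i
    using that insert.prems by (auto simp: \<rho>_def split: prod.splits if_splits)
  have "inj_on \<pi>' (SIGMA k:insert M' (insert k K). {2..d k})"
  proof (rule inj_onI, clarify)
    fix l i l' i'
    assume l: "l \<in> insert M' (insert k K)" "i \<in> {2..d l}"
      and l': "l' \<in> insert M' (insert k K)" "i' \<in> {2..d l'}"
      and eq: "\<pi>' (l, i) = \<pi>' (l', i')"
    consider "l = k" "l' = k" | "l = k" "l' \<noteq> k" | "l \<noteq> k" "l' = k" | "l \<noteq> k" "l' \<noteq> k" by blast
    then show "l = l' \<and> i = i'"
    proof cases
      case 1
      then show ?thesis using eq by (simp add: \<pi>'_def)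
    next
      case 2
      then show ?thesis using eq \<rho>M[of i "\<pi> (l', i')"] l by (simp add: \<pi>'_def)
    next
      case 3
      then show ?thesis using eq \<rho>M[of i' "\<pi> (l, i)"] l' by (simp add: \<pi>'_def)
    next
      case 4
      then have mem: "l \<in> insert M' K" "l' \<in> insert M' K" using l l' by auto
      have \<pi>_mem: "\<pi> (l, i) \<in> insert M K \<times> UNIV" "\<pi> (l', i') \<in> insert M K \<times> UNIV"
        using \<pi>[OF mem(1) l(2)] \<pi>[OF mem(2) l'(2)] by auto
      have "\<pi>' (l, i) = \<rho> (\<pi> (l, i))" "\<pi>' (l', i') = \<rho> (\<pi> (l', i'))"
        using 4 by (simp_all add: \<pi>'_def)
      then have "\<rho> (\<pi> (l, i)) = \<rho> (\<pi> (l', i'))"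
        using eq by metis
      from inj_onD[OF \<rho> this \<pi>_mem] have "\<pi> (l, i) = \<pi> (l', i')" .
      moreover have "(l, i) \<in> (SIGMA k:insert M' K. {2..d k})" "(l', i') \<in> (SIGMA k:insert M' K. {2..d k})"
        using mem l(2) l'(2) by blast+
      ultimately have "(l, i) = (l', i')"
        by (rule inj_onD[OF inj])
      then show ?thesis by blast
    qed
  qed
  moreover have "\<exists>l'\<in>insert M (insert k K). \<exists>a\<in>{2..d l'}. \<pi>' (l, i) = (l', a) \<and> l' \<noteq> l"
    if l: "l \<in> insert M' (insert k K)" "i \<in> {2..d l}" for l i
  proof (cases "l = k")
    case True
    then show ?thesis using insert.prems l by (auto simp: \<pi>'_def)
  next
    case False
    then have mem: "l \<in> insert M' K" using l by auto
    obtain l' a where "l' \<in> insert M K" "a \<in> {2..d l'}" "\<pi> (l, i) = (l', a)" "l' \<noteq> l"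
      using \<pi>[OF mem l(2)] by blast
    then show ?thesis using False by (auto simp: \<pi>'_def \<rho>_def)
  qed
  ultimately show ?case by blast
qed

section \<open>The family of points and games: lambda (\<open>Value\<close>), x
  (\<open>Weight\<close>), sigma (\<open>Interaction\<close>), free payoffs
  (\<open>Payoff\<close>)\<close>

datatype parameter =
    Value nat
  | Weight nat nat
  | Interaction nat
  | Payoff "nat \<times> (nat \<Rightarrow> nat)"

locale max_player_edge =
  fixes n :: nat and d :: "nat \<Rightarrow> nat" and E :: "nat set set" and M M' :: nat
  assumes two: "\<And>i. i \<in> {1..n} \<Longrightarrow> 2 \<le> d i"
    and M: "M \<in> {1..n}" and M': "M' \<in> {1..n}" and MM': "M \<noteq> M'"
    and edge: "{M, M'} \<in> E"
    and max: "\<And>i. i \<in> {1..n} \<Longrightarrow> d i \<le> d M"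
begin

definition weight :: "(parameter \<Rightarrow> complex) \<Rightarrow> nat \<Rightarrow> nat \<Rightarrow> complex" where
  "weight t l a = (if l = M' \<or> a = 1 then 1 else t (Weight l a))"

definition interaction :: "(parameter \<Rightarrow> complex) \<Rightarrow> (nat \<Rightarrow> nat) \<Rightarrow> complex" where
  "interaction t j = (if j M' = 2 \<and> j M \<noteq> 1 then t (Interaction (j M)) else 1)"

definition point :: "(parameter \<Rightarrow> complex) \<Rightarrow> (nat \<Rightarrow> nat) \<Rightarrow> complex" where
  "point t j = (\<Prod>l\<in>{1..n}. weight t l (j l)) * interaction t j"

definition star :: "nat \<Rightarrow> nat \<Rightarrow> nat \<Rightarrow> nat" where
  "star k i = (\<lambda>l\<in>{1..n}. if l = k then i else 1)"

text \<open>
  \<open>ratio t k j\<close> is \<open>point t j\<close> divided by \<open>point t (star k (j k))\<close>, written without division.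
\<close>

definition ratio :: "(parameter \<Rightarrow> complex) \<Rightarrow> nat \<Rightarrow> (nat \<Rightarrow> nat) \<Rightarrow> complex" where
  "ratio t k j = (\<Prod>l\<in>{1..n} - {k}. weight t l (j l)) * interaction t j"

definition slice :: "nat \<Rightarrow> nat \<Rightarrow> (nat \<Rightarrow> nat) set" where
  "slice k i = {j \<in> profiles d {1..n}. j k = i}"

text \<open>
  The payoff of player \<open>k\<close> at \<open>star k i\<close> is determined by the condition that her conditional payoff
  from strategy \<open>i\<close> at \<open>point t\<close> is \<open>t (Value k)\<close>; all other payoffs are parameters.
\<close>

definition game_of :: "(parameter \<Rightarrow> complex) \<Rightarrow> nat \<times> (nat \<Rightarrow> nat) \<Rightarrow> complex" where
  "game_of t = (\<lambda>(k, j). if j = star k (j k)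
     then t (Value k) - (\<Sum>m\<in>slice k (j k) - {j}. (t (Payoff (k, m)) - t (Value k)) * ratio t k m)
     else t (Payoff (k, j)))"

definition parameters :: "parameter set" where
  "parameters = Value ` {1..n} \<union> (\<Union>l\<in>{1..n}. Weight l ` {1..d l}) \<union> Interaction ` {1..d M}
     \<union> Payoff ` game_index n d"

lemma finite_profiles: "finite (profiles d {1..n})"
  unfolding profiles_def by (intro finite_PiE) auto

lemma finite_slice: "finite (slice k i)"
  unfolding slice_def using finite_profiles by simp

lemma finite_parameters: "finite parameters"
  unfolding parameters_def game_index_def using finite_profiles by auto

lemma profileD: "j \<in> profiles d {1..n} \<Longrightarrow> l \<in> {1..n} \<Longrightarrow> j l \<in> {1..d l}"
  unfolding profiles_def by (rule PiE_mem)

lemma star_in_slice: "k \<in> {1..n} \<Longrightarrow> i \<in> {1..d k} \<Longrightarrow> star k i \<in> slice k i"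
  using two by (fastforce simp: slice_def star_def profiles_def)

lemma polyfun_weight:
  "l \<in> {1..n} \<Longrightarrow> a \<in> {1..d l} \<Longrightarrow> polyfun parameters (\<lambda>t. weight t l a)"
  unfolding weight_def
  by (cases "l = M' \<or> a = 1") (auto simp: parameters_def intro!: polyfun.intros)

lemma polyfun_interaction:
  "j \<in> profiles d {1..n} \<Longrightarrow> polyfun parameters (\<lambda>t. interaction t j)"
  unfolding interaction_def using profileD[OF _ M, of j]
  by (cases "j M' = 2 \<and> j M \<noteq> 1") (auto simp: parameters_def intro!: polyfun.intros)

lemma polyfun_point: "j \<in> profiles d {1..n} \<Longrightarrow> polyfun parameters (\<lambda>t. point t j)"
  unfolding point_def
  by (intro polyfun.mult polyfun_prod polyfun_weight polyfun_interaction profileD)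

lemma polyfun_ratio: "j \<in> profiles d {1..n} \<Longrightarrow> polyfun parameters (\<lambda>t. ratio t k j)"
  unfolding ratio_def
  by (intro polyfun.mult polyfun_prod polyfun_weight polyfun_interaction profileD) auto

lemma polyfun_game_of:
  assumes "kj \<in> game_index n d"
  shows "polyfun parameters (\<lambda>t. game_of t kj)"
proof -
  obtain k j where kj: "kj = (k, j)" "k \<in> {1..n}" "j \<in> profiles d {1..n}"
    using assms by (auto simp: game_index_def)
  have "polyfun parameters (\<lambda>t. t (Value k))"
    using kj by (auto simp: parameters_def intro: polyfun.coord)
  moreover have "polyfun parameters (\<lambda>t. t (Payoff (k, m)))" if "m \<in> profiles d {1..n}" for m
    using kj that by (auto simp: parameters_def game_index_def intro: polyfun.coord)
  moreover have "m \<in> profiles d {1..n}" if "m \<in> slice k (j k) - {j}" for m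
    using that by (simp add: slice_def)
  ultimately show ?thesis
    unfolding kj(1) game_of_def using kj(3)
    by (cases "j = star k (j k)")
      (auto intro!: polyfun_diff polyfun_sum polyfun.mult polyfun_ratio)
qed

section \<open>Points of the family on the Spohn CI variety\<close>

lemma point_eq_weight_ratio: "k \<in> {1..n} \<Longrightarrow> point t j = weight t k (j k) * ratio t k j"
  unfolding point_def ratio_def by (simp add: prod.remove[of _ k] mult.assoc)

text \<open>All players other than \<open>k\<close> use strategy 1, which has weight 1, and the
  interaction requires both \<open>M\<close> and \<open>M'\<close> to leave strategy 1.\<close>

lemma ratio_star: "k \<in> {1..n} \<Longrightarrow> ratio t k (star k i) = 1"
  using M M' MM' by (auto simp: ratio_def star_def weight_def interaction_def intro!: prod.neutral)

text \<open>With the factor \<open>weight t k i\<close> taken out, the condition is linear in the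
  payoffs, and the payoff at \<open>star k i\<close> has coefficient 1; \<open>game_of\<close>
  contains its solution.\<close>

lemma payoff_sum_point:
  assumes X: "\<And>kj. kj \<in> game_index n d \<Longrightarrow> game_of t kj = complex_of_real (X kj)"
    and k: "k \<in> {1..n}" and i: "i \<in> {1..d k}"
  shows "payoff_sum n d X k i (point t) = t (Value k) * marginal n d k i (point t)"
proof -
  define S where "S = slice k i - {star k i}"
  have star: "star k i \<in> slice k i" using star_in_slice[OF k i] .
  have gi: "(k, j) \<in> game_index n d" "j k = i" if "j \<in> slice k i" for j
    using that k by (auto simp: game_index_def slice_def)
  have Xstar: "complex_of_real (X (k, star k i)) - t (Value k) =
      - (\<Sum>m\<in>S. (t (Payoff (k, m)) - t (Value k)) * ratio t k m)"
    using X[OF gi(1)[OF star]] gi(2)[OF star] by (simp add: game_of_def S_def flip: X[OF gi(1)[OF star]])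
  have Xother: "complex_of_real (X (k, m)) = t (Payoff (k, m))" if "m \<in> S" for m
    using that X[OF gi(1), of m] gi(2)[of m] by (auto simp: game_of_def S_def)
  have "payoff_sum n d X k i (point t) - t (Value k) * marginal n d k i (point t)
      = (\<Sum>j\<in>slice k i. (complex_of_real (X (k, j)) - t (Value k)) * point t j)"
    by (simp add: payoff_sum_def marginal_def slice_def sum_distrib_left sum_subtractf algebra_simps)
  also have "\<dots> = (\<Sum>j\<in>slice k i. weight t k i * ((complex_of_real (X (k, j)) - t (Value k)) * ratio t k j))"
    by (intro sum.cong refl) (auto simp: point_eq_weight_ratio[OF k] slice_def)
  also have "\<dots> = weight t k i * (\<Sum>j\<in>slice k i. (complex_of_real (X (k, j)) - t (Value k)) * ratio t k j)"
    by (simp add: sum_distrib_left)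
  also have "(\<Sum>j\<in>slice k i. (complex_of_real (X (k, j)) - t (Value k)) * ratio t k j)
      = (complex_of_real (X (k, star k i)) - t (Value k)) +
        (\<Sum>j\<in>S. (complex_of_real (X (k, j)) - t (Value k)) * ratio t k j)"
    by (simp add: sum.remove[OF finite_slice star] S_def ratio_star[OF k])
  also have "\<dots> = 0"
    by (simp add: Xstar Xother)
  finally show ?thesis by simp
qed

lemma ex_maximal_clique:
  assumes "clique n E C"
  shows "\<exists>D\<in>maximal_cliques n E. C \<subseteq> D"
proof -
  have "finite {D. clique n E D}"
    by (rule finite_subset[of _ "Pow {1..n}"]) (auto simp: clique_def)
  from finite_has_maximal2[OF this, of C] assms
  obtain D where "clique n E D" "C \<subseteq> D" "\<And>D'. clique n E D' \<Longrightarrow> D \<subseteq> D' \<Longrightarrow> D = D'" by auto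
  then show ?thesis
    by (intro bexI[of _ D]) (auto simp: maximal_cliques_def)
qed

lemma point_eq_clique_parametrization:
  "\<exists>\<sigma>. clique_parametrization n d E \<sigma> = restrict (point t) (profiles d {1..n})"
proof -
  have "clique n E {M, M'}"
    using M M' edge by (auto simp: clique_def insert_commute)
  then obtain C0 where C0: "C0 \<in> maximal_cliques n E" "M \<in> C0" "M' \<in> C0"
    using ex_maximal_clique by fastforce
  have "\<exists>C\<in>maximal_cliques n E. l \<in> C" if "l \<in> {1..n}" for l
    using ex_maximal_clique[of "{l}"] that by (auto simp: clique_def)
  then obtain c where c: "\<And>l. l \<in> {1..n} \<Longrightarrow> c l \<in> maximal_cliques n E \<and> l \<in> c l"
    by metis
  have fin: "finite (maximal_cliques n E)"
    by (rule finite_subset[of _ "Pow {1..n}"]) (auto simp: maximal_cliques_def clique_def)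
  \<comment> \<open>Every vertex puts its weight into one chosen maximal clique containing it; the
    interaction goes into a maximal clique containing the edge.\<close>
  define \<sigma> where "\<sigma> = (\<lambda>C u. (\<Prod>l\<in>{l \<in> {1..n}. c l = C}. weight t l (u l)) *
    (if C = C0 then interaction t u else 1))"
  have "(\<Prod>C\<in>maximal_cliques n E. \<sigma> C (restrict j C)) = point t j" for j
  proof -
    have "\<sigma> C (restrict j C) = (\<Prod>l\<in>{l \<in> {1..n}. c l = C}. weight t l (j l)) *
        (if C = C0 then interaction t j else 1)" for C
    proof -
      have "weight t l (restrict j C l) = weight t l (j l)" if "l \<in> {l \<in> {1..n}. c l = C}" for l
        using that c[of l] by auto
      then show ?thesis
        using C0 by (simp add: \<sigma>_def interaction_def)
    qed
    then have "(\<Prod>C\<in>maximal_cliques n E. \<sigma> C (restrict j C)) =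
        (\<Prod>C\<in>maximal_cliques n E. \<Prod>l\<in>{l \<in> {1..n}. c l = C}. weight t l (j l)) * interaction t j"
      using C0 fin by (simp add: prod.distrib prod.delta)
    also have "(\<Prod>C\<in>maximal_cliques n E. \<Prod>l\<in>{l \<in> {1..n}. c l = C}. weight t l (j l)) =
        (\<Prod>l\<in>{1..n}. weight t l (j l))"
      using c by (intro prod.group fin) auto
    finally show ?thesis unfolding point_def .
  qed
  then show ?thesis
    by (intro exI[of _ \<sigma>]) (simp add: clique_parametrization_def)
qed

text \<open>The class of \<open>point t\<close> is a witness before taking the closure: the second
  column of each matrix is \<open>t (Value k)\<close> times the first, so all minors vanish.\<close>

lemma spohn_CI_variety_nonempty:
  assumes X: "\<And>kj. kj \<in> game_index n d \<Longrightarrow> game_of t kj = complex_of_real (X kj)"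
    and nz: "\<And>j. j \<in> profiles d {1..n} \<Longrightarrow> point t j \<noteq> 0"
    and sum: "(\<Sum>j\<in>profiles d {1..n}. point t j) \<noteq> 0"
  shows "spohn_CI_variety n d X E \<noteq> {}"
proof -
  let ?I = "profiles d {1..n}"
  define p where "p = restrict (point t) ?I"
  define x where "x = proportional ?I `` {p}"
  have "star M 1 \<in> ?I"
    using star_in_slice[OF M, of 1] two[OF M] by (auto simp: slice_def)
  then have p: "p \<in> nonzero_vectors ?I"
    using nz by (auto simp: p_def nonzero_vectors_def)
  then have px: "p \<in> x"
    by (auto simp: x_def proportional_def intro: exI[of _ 1])
  have x: "x \<in> proj_space ?I"
    using p by (auto simp: x_def proj_space_def intro: quotientI)
  have q: "\<exists>c. \<forall>j\<in>?I. q j = c * point t j" if "q \<in> x" for q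
    using that by (auto simp: x_def proportional_def p_def)
  have "x \<in> spohn_variety n d X"
    unfolding spohn_variety_def
  proof (intro CollectI conjI ballI x)
    fix q k i i' assume "q \<in> x" and k: "k \<in> {1..n}" and i: "i \<in> {1..d k}" "i' \<in> {1..d k}"
    then obtain c where c: "\<And>j. j \<in> ?I \<Longrightarrow> q j = c * point t j" using q by blast
    have "marginal n d k i q = c * marginal n d k i (point t)"
      "payoff_sum n d X k i q = c * payoff_sum n d X k i (point t)" for i
      unfolding marginal_def payoff_sum_def sum_distrib_left
      by (auto intro!: sum.cong simp: c)
    then show "marginal n d k i q * payoff_sum n d X k i' q - marginal n d k i' q * payoff_sum n d X k i q = 0"
      by (simp add: payoff_sum_point[OF X k i(1)] payoff_sum_point[OF X k i(2)])
  qed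
  moreover have "x \<in> graphical_model n d E"
  proof -
    obtain \<sigma> where "clique_parametrization n d E \<sigma> = p"
      using point_eq_clique_parametrization[of t] by (auto simp: p_def)
    then have "\<exists>\<sigma>. clique_parametrization n d E \<sigma> \<in> x"
      using px by (intro exI[of _ \<sigma>]) simp
    then show ?thesis
      unfolding graphical_model_def proj_closure_def using x by (intro hull_inc) simp
  qed
  moreover have "\<exists>p\<in>x. p j \<noteq> 0" if "j \<in> ?I" for j
    using that nz by (intro bexI[OF _ px]) (simp add: p_def)
  moreover have "\<exists>p\<in>x. sum p ?I \<noteq> 0"
    using sum by (intro bexI[OF _ px]) (simp add: p_def)
  ultimately have "x \<in> spohn_variety n d X \<inter> graphical_model n d E - excluded_hyperplanes n d"
    unfolding excluded_hyperplanes_def by blast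
  then show ?thesis
    unfolding spohn_CI_variety_def proj_closure_def by (auto intro: hull_inc)
qed

section \<open>Dominance from surjectivity of the derivative\<close>

lemma game_of_dominant:
  assumes P: "polyfun (game_index n d) P" and P0: "\<And>t. P (game_of t) = 0"
  shows "P = 0"
proof -
  define R where "R = (SIGMA k:{1..n} - {M}. {2..d k})"
  have K: "insert M' ({1..n} - {M, M'}) = {1..n} - {M}" "insert M ({1..n} - {M, M'}) = {1..n} - {M'}"
    using M M' MM' by auto
  have "\<exists>\<pi>. inj_on \<pi> R \<and> (\<forall>k\<in>{1..n} - {M}. \<forall>i\<in>{2..d k}.
      \<exists>l\<in>{1..n} - {M'}. \<exists>a\<in>{2..d l}. \<pi> (k, i) = (l, a) \<and> l \<noteq> k)"
    using deviation_matching[of "{1..n} - {M, M'}" M M' d] MM' max unfolding K R_def by simp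
  then obtain \<pi> where inj: "inj_on \<pi> R"
    and \<pi>: "\<And>k i. k \<in> {1..n} - {M} \<Longrightarrow> i \<in> {2..d k} \<Longrightarrow>
      \<exists>l\<in>{1..n} - {M'}. \<exists>a\<in>{2..d l}. \<pi> (k, i) = (l, a) \<and> l \<noteq> k"
    by blast
  \<comment> \<open>Deviation \<open>i\<close> of \<open>k\<close> is paired with a strategy
    \<open>a\<close> of another player \<open>l\<close>. For \<open>k = M\<close> the partner
    (\<open>M'\<close>, 2) switches on sigma_i; for other players the matching selects the
    coordinate x^l_a.\<close>
  define mate where "mate = (\<lambda>k i. if k = M then (M', 2) else \<pi> (k, i))"
  have mate: "\<exists>l a. mate k i = (l, a) \<and> l \<in> {1..n} \<and> l \<noteq> k \<and> a \<in> {2..d l} \<and> (k \<noteq> M \<longrightarrow> l \<noteq> M')"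
    if "k \<in> {1..n}" "i \<in> {2..d k}" for k i
  proof (cases "k = M")
    case True
    then show ?thesis using M' MM' two[OF M'] by (simp add: mate_def)
  next
    case False
    then have "k \<in> {1..n} - {M}" using that by blast
    from \<pi>[OF this that(2)] obtain l a where "l \<in> {1..n} - {M'}" "a \<in> {2..d l}" "\<pi> (k, i) = (l, a)" "l \<noteq> k"
      by blast
    then show ?thesis using False by (simp add: mate_def)
  qed
  define dev where "dev = (\<lambda>k i. (star k i)(fst (mate k i) := snd (mate k i)))"
  have dev: "dev k i \<in> slice k i - {star k i}" if k: "k \<in> {1..n}" "i \<in> {2..d k}" for k i
  proof -
    obtain l a where la: "mate k i = (l, a)" "l \<in> {1..n}" "l \<noteq> k" "a \<in> {2..d l}"
      using mate[OF k] by blast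
    have "star k i \<in> profiles d {1..n}"
      using star_in_slice[of k i] k by (simp add: slice_def)
    then have "(star k i)(l := a) \<in> profiles d {1..n}"
      using la by (auto simp: profiles_def PiE_iff extensional_def)
    moreover have "((star k i)(l := a)) l \<noteq> star k i l"
      using la by (simp add: star_def)
    then have "(star k i)(l := a) \<noteq> star k i" by metis
    moreover have "((star k i)(l := a)) k = i"
      using la k by (simp add: star_def)
    ultimately show ?thesis
      using la by (simp add: dev_def slice_def)
  qed
  \<comment> \<open>The free payoffs are 1 at the profiles \<open>dev k i\<close> and 0 elsewhere,
    so in equation (k, i) only the ratio at \<open>dev k i\<close> contributes to first
    order.\<close>
  define t0 where "t0 = (\<lambda>v. case v of Value k \<Rightarrow> 0 | Weight l a \<Rightarrow> 1 | Interaction a \<Rightarrow> 1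
    | Payoff km \<Rightarrow> (if 2 \<le> snd km (fst km) \<and> snd km = dev (fst km) (snd km (fst km)) then 1 else 0 :: complex))"
  show ?thesis
  proof (rule polyfun_eq_0_if_all_tangents[OF P, of "game_of t0"])
    fix w :: "nat \<times> (nat \<Rightarrow> nat) \<Rightarrow> complex"
    \<comment> \<open>Let the free payoffs move along \<open>w\<close> and \<open>Value k\<close>
      along \<open>val k\<close>. The payoff at \<open>star k i\<close> then also moves along
      \<open>w\<close> iff the ratios contribute \<open>r k i\<close>. The average
      \<open>val k\<close> makes \<open>r k 1\<close> vanish, as strategy 1 has no coordinate of its
      own.\<close>
    define W where "W = (\<lambda>k i. \<Sum>m\<in>slice k i. w (k, m))"
    define N where "N = (\<lambda>k i. of_nat (card (slice k i)) :: complex)"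
    define val where "val = (\<lambda>k. W k 1 / N k 1)"
    define r where "r = (\<lambda>k i. val k * N k i - W k i)"
    define act where "act = (\<lambda>k i. dev k i M' = 2 \<and> dev k i M \<noteq> 1)"
    \<comment> \<open>The inverse of \<pi> finds the deviation served by a weight. The subtracted
      term compensates for the interaction at \<open>dev k i\<close>, which for
      \<open>k \<noteq> M\<close> occurs only if \<open>k = M'\<close>, \<open>i = 2\<close> and the
      partner is \<open>M\<close>.\<close>
    define \<xi> where "\<xi> = (\<lambda>la. case inv_into R \<pi> la of (k, i) \<Rightarrow>
      r k i - (if act k i then r M (dev k i M) else 0))"
    define dir where "dir = (\<lambda>v. case v of Value k \<Rightarrow> val k | Weight l a \<Rightarrow> \<xi> (l, a)
      | Interaction a \<Rightarrow> r M a | Payoff km \<Rightarrow> w km)"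
    define t where "t = (\<lambda>s v. t0 v + s * dir v)"
    have t_simps: "t s (Value k) = s * val k" "t s (Weight l a) = 1 + s * \<xi> (l, a)"
      "t s (Interaction a) = 1 + s * r M a" "t s (Payoff km) = t0 (Payoff km) + s * w km" for s k l a km
      by (simp_all add: t_def t0_def dir_def)
    have t_0: "t 0 = t0" by (simp add: t_def)
    have "weight t0 l a = 1" "interaction t0 m = 1" for l a m
      by (simp_all add: weight_def interaction_def t0_def)
    then have ratio0: "ratio t0 k m = 1" for k m
      by (simp add: ratio_def)
    \<comment> \<open>Along the line \<open>t\<close> each ratio is a univariate polynomial in
      \<open>s\<close>, hence differentiable.\<close>
    define p where "p = (\<lambda>k m. SOME p. \<forall>s. ratio (t s) k m = poly p s)"
    have p: "ratio (t s) k m = poly (p k m) s" if m: "m \<in> profiles d {1..n}" for k m s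
    proof -
      have "\<exists>p. \<forall>s. ratio (t s) k m = poly p s"
        unfolding t_def by (rule polyfun_on_line[OF polyfun_ratio[OF m]])
      from someI_ex[OF this] show ?thesis unfolding p_def by blast
    qed
    define D where "D = (\<lambda>k m. poly (pderiv (p k m)) 0)"
    have D: "((\<lambda>s. ratio (t s) k m) has_field_derivative D k m) (at 0)"
      if "m \<in> profiles d {1..n}" for k m
      using that by (simp add: p D_def poly_DERIV)
    have D_dev: "D k (dev k i) = r k i" if k: "k \<in> {1..n}" "i \<in> {2..d k}" for k i
    proof -
      obtain l a where la: "mate k i = (l, a)" "l \<in> {1..n}" "l \<noteq> k" "a \<in> {2..d l}" "k \<noteq> M \<longrightarrow> l \<noteq> M'"
        using mate[OF k] by blast
      have prof: "dev k i \<in> profiles d {1..n}"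
        using dev[OF k] by (simp add: slice_def)
      have ratio: "ratio (t s) k (dev k i) = weight (t s) l a * interaction (t s) (dev k i)" for s
      proof -
        have "(\<Prod>l'\<in>{1..n} - {k}. weight (t s) l' (dev k i l')) =
            weight (t s) l (dev k i l) * (\<Prod>l'\<in>{1..n} - {k} - {l}. weight (t s) l' (dev k i l'))"
          using la by (intro prod.remove) auto
        also have "(\<Prod>l'\<in>{1..n} - {k} - {l}. weight (t s) l' (dev k i l')) = 1"
          using la by (intro prod.neutral) (auto simp: dev_def star_def weight_def)
        finally show ?thesis using la by (simp add: ratio_def dev_def)
      qed
      have "((\<lambda>s. ratio (t s) k (dev k i)) has_field_derivative r k i) (at 0)"
      proof (cases "k = M")
        case True
        \<comment> \<open>All weights of \<open>M'\<close> are 1, so for \<open>k = M\<close> only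
          the interaction moves.\<close>
        then have "l = M'" "a = 2" using la by (auto simp: mate_def)
        then have "interaction (t s) (dev k i) = 1 + s * r M i" for s
          using True k la M MM' by (simp add: interaction_def dev_def star_def t_simps)
        then show ?thesis
          unfolding ratio using True \<open>l = M'\<close>
          by (auto simp: weight_def intro!: derivative_eq_intros)
      next
        case False
        have kR: "(k, i) \<in> R" using k False by (simp add: R_def)
        have "\<pi> (k, i) = (l, a)" using la False by (simp add: mate_def)
        then have "inv_into R \<pi> (l, a) = (k, i)"
          using inv_into_f_f[OF inj kR] by simp
        then have "\<xi> (l, a) = r k i - (if act k i then r M (dev k i M) else 0)"
          by (simp add: \<xi>_def)
        moreover have "weight (t s) l a = 1 + s * \<xi> (l, a)" for s
          using la False by (simp add: weight_def t_simps)
        moreover have "interaction (t s) (dev k i) = 1 + s * (if act k i then r M (dev k i M) else 0)" for s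
          by (simp add: interaction_def act_def t_simps)
        \<comment> \<open>By the product rule at \<open>s = 0\<close> the two derivatives add up,
          and the correction in \<xi> cancels that of the interaction.\<close>
        ultimately show ?thesis
          unfolding ratio by (auto intro!: derivative_eq_intros)
      qed
      then show ?thesis
        using D[OF prof] by (rule DERIV_unique[rotated])
    qed
    show "\<exists>\<gamma>. (\<forall>s. P (\<gamma> s) = 0) \<and> (\<forall>kj\<in>game_index n d. \<gamma> 0 kj = game_of t0 kj \<and>
        ((\<lambda>s. \<gamma> s kj) has_field_derivative w kj) (at 0))"
    proof (intro exI[of _ "\<lambda>s. game_of (t s)"] conjI allI ballI)
      fix s show "P (game_of (t s)) = 0" by (rule P0)
    next
      fix kj show "game_of (t 0) kj = game_of t0 kj" by (simp add: t_0)
    next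
      fix kj assume "kj \<in> game_index n d"
      then obtain k j where kj: "kj = (k, j)" "k \<in> {1..n}" "j \<in> profiles d {1..n}"
        unfolding game_index_def by blast
      show "((\<lambda>s. game_of (t s) kj) has_field_derivative w kj) (at 0)"
      proof (cases "j = star k (j k)")
        case False
        then have "game_of (t s) kj = t0 (Payoff kj) + s * w kj" for s
          by (simp add: game_of_def kj t_simps)
        then show ?thesis
          by (auto intro!: derivative_eq_intros)
      next
        case True
        define i where "i = j k"
        define S where "S = slice k i - {j}"
        have j: "j = star k i" using True by (simp add: i_def)
        have i: "i \<in> {1..d k}" using profileD[OF kj(3,2)] by (simp add: i_def)
        have jS: "j \<in> slice k i" using kj by (simp add: slice_def i_def)
        have S_prof: "m \<in> profiles d {1..n}" "m k = i" if "m \<in> S" for m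
          using that by (simp_all add: S_def slice_def)
        have game: "game_of (t s) kj =
            s * val k - (\<Sum>m\<in>S. (t0 (Payoff (k, m)) + s * (w (k, m) - val k)) * ratio (t s) k m)" for s
        proof -
          have "game_of (t s) kj = t s (Value k) -
              (\<Sum>m\<in>S. (t s (Payoff (k, m)) - t s (Value k)) * ratio (t s) k m)"
            unfolding S_def i_def game_of_def kj(1) using True by simp
          then show ?thesis by (simp add: t_simps algebra_simps)
        qed
        have "((\<lambda>s. (t0 (Payoff (k, m)) + s * (w (k, m) - val k)) * ratio (t s) k m) has_field_derivative
            (w (k, m) - val k) + t0 (Payoff (k, m)) * D k m) (at 0)" if "m \<in> S" for m
          by (rule derivative_eq_intros D S_prof[OF that] refl)+ (simp add: t_0 ratio0)
        then have "((\<lambda>s. \<Sum>m\<in>S. (t0 (Payoff (k, m)) + s * (w (k, m) - val k)) * ratio (t s) k m)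
            has_field_derivative (\<Sum>m\<in>S. (w (k, m) - val k) + t0 (Payoff (k, m)) * D k m)) (at 0)"
          by (rule DERIV_sum)
        moreover have "((\<lambda>s. s * val k) has_field_derivative val k) (at 0)"
          by (auto intro!: derivative_eq_intros)
        ultimately have deriv: "((\<lambda>s. game_of (t s) kj) has_field_derivative
            val k - (\<Sum>m\<in>S. (w (k, m) - val k) + t0 (Payoff (k, m)) * D k m)) (at 0)"
          unfolding game by (intro DERIV_diff)
        \<comment> \<open>The one place where the choice of direction matters: it gives the
          contribution of the ratios required of equation (k, i).\<close>
        have sumD: "(\<Sum>m\<in>S. t0 (Payoff (k, m)) * D k m) = r k i"
        proof (cases "i = 1")
          case True
          have "slice k 1 \<noteq> {}" using jS True by blast
          then have "r k i = 0"
            using True finite_slice by (simp add: r_def val_def N_def)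
          moreover have "t0 (Payoff (k, m)) = 0" if "m \<in> S" for m
            using S_prof(2)[OF that] True by (simp add: t0_def)
          ultimately show ?thesis by simp
        next
          case False
          then have i2: "i \<in> {2..d k}" using i by simp
          note dev_i = dev[OF kj(2) i2]
          have "finite S" by (simp add: S_def finite_slice)
          moreover have "dev k i \<in> S" using dev_i by (simp add: S_def j)
          moreover have "t0 (Payoff (k, m)) = (if m = dev k i then 1 else 0)" if "m \<in> S" for m
            using S_prof(2)[OF that] i2 by (simp add: t0_def)
          ultimately have "(\<Sum>m\<in>S. t0 (Payoff (k, m)) * D k m) = D k (dev k i)"
            by (simp add: sum.remove[of S "dev k i"])
          then show ?thesis using D_dev[OF kj(2) i2] by simp
        qed
        have sumw: "(\<Sum>m\<in>S. w (k, m)) = W k i - w kj"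
          using sum.remove[OF finite_slice jS, of "\<lambda>m. w (k, m)"] by (simp add: W_def S_def kj)
        have cardS: "of_nat (card S) = N k i - 1"
          using card.remove[OF finite_slice jS] by (simp add: N_def S_def)
        have "val k - (\<Sum>m\<in>S. (w (k, m) - val k) + t0 (Payoff (k, m)) * D k m) =
            val k - ((\<Sum>m\<in>S. w (k, m)) - of_nat (card S) * val k + (\<Sum>m\<in>S. t0 (Payoff (k, m)) * D k m))"
          by (simp add: sum.distrib sum_subtractf)
        also have "\<dots> = w kj"
          unfolding sumD sumw cardS r_def by (simp add: algebra_simps)
        finally have "val k - (\<Sum>m\<in>S. (w (k, m) - val k) + t0 (Payoff (k, m)) * D k m) = w kj" .
        with deriv show ?thesis by simp
      qed
    qed
  qed
qed

text \<open>All nonvanishing conditions are put into one polynomial \<open>F\<close> on the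
  parameters; it is nonzero because at the all-ones parameter every coordinate of the point is
  1.\<close>

lemma generic_spohn_CI_variety_nonempty:
  "generic (game_index n d) (\<lambda>X. spohn_CI_variety n d X E \<noteq> {})"
proof -
  define F where "F = (\<lambda>t. (\<Prod>j\<in>profiles d {1..n}. point t j) * (\<Sum>j\<in>profiles d {1..n}. point t j))"
  have F: "polyfun parameters F"
    unfolding F_def by (intro polyfun.mult polyfun_prod polyfun_sum polyfun_point)
  have "point (\<lambda>_. 1) j = 1" for j
    by (simp add: point_def weight_def interaction_def)
  moreover have "star M 1 \<in> profiles d {1..n}"
    using star_in_slice[OF M, of 1] two[OF M] by (simp add: slice_def)
  ultimately have "F (\<lambda>_. 1) \<noteq> 0"
    using finite_profiles by (auto simp: F_def)
  then have F0: "F \<noteq> 0" by auto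
  have "\<exists>G. polyfun (game_index n d) G \<and> G \<noteq> 0 \<and>
      (\<forall>X. G X \<noteq> 0 \<longrightarrow> (\<exists>t. F t \<noteq> 0 \<and> (\<forall>kj\<in>game_index n d. game_of t kj = X kj)))"
    by (rule dominant_image_contains_open[OF finite_parameters polyfun_game_of game_of_dominant F F0])
  then obtain G where G: "polyfun (game_index n d) G" "G \<noteq> 0"
    and lift: "\<And>X. G X \<noteq> 0 \<Longrightarrow> \<exists>t. F t \<noteq> 0 \<and> (\<forall>kj\<in>game_index n d. game_of t kj = X kj)"
    by blast
  show ?thesis
  proof (rule generic_if_complex_polyfun[OF G])
    fix X :: game assume "G (\<lambda>kj. complex_of_real (X kj)) \<noteq> 0"
    then obtain t where t: "F t \<noteq> 0"
      "\<And>kj. kj \<in> game_index n d \<Longrightarrow> game_of t kj = complex_of_real (X kj)"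
      using lift by blast
    show "spohn_CI_variety n d X E \<noteq> {}"
    proof (rule spohn_CI_variety_nonempty[OF t(2)])
      show "point t j \<noteq> 0" if "j \<in> profiles d {1..n}" for j
        using t(1) that finite_profiles by (auto simp: F_def)
      show "(\<Sum>j\<in>profiles d {1..n}. point t j) \<noteq> 0"
        using t(1) by (simp add: F_def)
    qed
  qed
qed

end

section \<open>Reduction of the three conditions to an edge at a player with most strategies\<close>

theorem corollary5p8:
  fixes n :: nat and d :: "nat \<Rightarrow> nat" and E :: "nat set set"
  assumes "n \<ge> 2"
    and "\<forall>i\<in>{1..n}. d i \<ge> 2"
    and "simple_graph n E"
    and "(\<exists>k\<in>{1..n}. (\<forall>i\<in>{1..n}. d i \<le> d k) \<and> \<not> isolated E k)
         \<or> (\<forall>k\<in>{1..n}. \<not> isolated E k)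
         \<or> connected_graph n E"
  shows "generic (game_index n d) (\<lambda>X. spohn_CI_variety n d X E \<noteq> {})"
proof -
  have conn: "\<not> isolated E k" if "connected_graph n E" "k \<in> {1..n}" for k
  proof -
    have "(if k = 1 then 2 else 1) \<in> {1..n}" "(if k = 1 then 2 else 1) \<noteq> k"
      using assms(1) by auto
    then obtain l where l: "l \<in> {1..n}" "l \<noteq> k" by blast
    \<comment> \<open>A path from \<open>k\<close> to a different vertex starts with an edge at
      \<open>k\<close>; the second vertex \<open>l\<close> exists because
      \<open>n \<ge> 2\<close>.\<close>
    then have "(k, l) \<in> {(x, y). {x, y} \<in> E}\<^sup>*"
      using that unfolding connected_graph_def by blast
    then obtain y where "{k, y} \<in> E"
      using l(2) by (cases rule: converse_rtranclE) auto
    then show ?thesis by (auto simp: isolated_def)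
  qed
  have "Max (d ` {1..n}) \<in> d ` {1..n}"
    using assms(1) by (intro Max_in) auto
  then obtain k0 where "k0 \<in> {1..n}" "d k0 = Max (d ` {1..n})"
    by (metis imageE)
  then have "k0 \<in> {1..n}" "\<forall>i\<in>{1..n}. d i \<le> d k0"
    by simp_all
  \<comment> \<open>Under conditions (2) and (3) no vertex is isolated, so any maximizer
    \<open>k0\<close> of \<open>d\<close> serves; condition (1) supplies one directly.\<close>
  then obtain k where k: "k \<in> {1..n}" "\<forall>i\<in>{1..n}. d i \<le> d k" "\<not> isolated E k"
    using assms(4) conn by blast
  then obtain e where e: "e \<in> E" "k \<in> e" unfolding isolated_def by blast
  then have card: "e \<subseteq> {1..n}" "card e = 2"
    using assms(3) unfolding simple_graph_def by blast+
  then obtain x y where "e = {x, y}" "x \<noteq> y" by (meson card_2_iff)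
  then obtain l where l: "e = {k, l}" "l \<noteq> k" "l \<in> {1..n}"
    using e(2) card(1) by blast
  interpret max_player_edge n d E k l
    by unfold_locales (use assms(2) k e l in auto)
  show ?thesis by (rule generic_spohn_CI_variety_nonempty)
qed

end
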